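(* Let $dM_0$ be of minimal decay over $\mathbb{A}_{\mathbb{M}}$ for a certain frequency. Then at least one of the two following statements holds: (i) $\|dM_0\|=m$; (ii) $a_*(dM_0)=0$.
   Context: Fix $\ell>0$ and $m>0$. A string is a bounded nonnegative Borel measure $dM$ on $[0,\ell]$; $\|dM\|$ is its total mass. For $z\in\mathbb{C}$, $\varphi(\cdot)=\varphi(\cdot,z;dM)$ is the unique continuous solution on $[0,\ell]$ of $\varphi(x)=1-z^2\int_{[0,x]}(x-s)\varphi(s)\,dM(s)$, and $F(z;dM):=\varphi(\ell,z;dM)-iz\int_{[0,\ell]}\varphi(s,z;dM)\,dM(s)$. The set $\Sigma(dM)$ of quasi-eigenvalues of $dM$ is the set of zeroes of $F(\cdot;dM)$. $\mathbb{A}_{\mathbb{M}}$ is the set of nonnegative Borel measures on $[0,\ell]$ with total mass $\le m$, and $\Sigma[\mathbb{A}_{\mathbb{M}}]:=\bigcup_{dM\in\mathbb{A}_{\mathbb{M}}}\Sigma(dM)$. For $\alpha\in\mathbb{R}$ (a frequency), $\beta_{\min}(\alpha):=\inf\{\beta\in\mathbb{R}:\alpha-i\beta\in\Sigma[\mathbb{A}_{\mathbb{M}}]\}$; a string $dM\in\mathbb{A}_{\mathbb{M}}$ is of minimal decay for the frequency $\alpha$ over $\mathbb{A}_{\mathbb{M}}$ if $\alpha-i\beta_{\min}(\alpha)\in\Sigma(dM)$. $a_*(dM):=\min\operatorname{supp}dM$ if $dM$ is nonzero, and $a_*(dM):=\ell$ otherwise. *)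

theory Defs
  imports "HOL-Analysis.Analysis"
begin

definition is_string :: "real \<Rightarrow> real measure \<Rightarrow> bool" where
  "is_string l M \<longleftrightarrow> sets M = sets (restrict_space borel {0..l}) \<and> finite_measure M"

definition total_mass :: "real measure \<Rightarrow> real" where
  "total_mass M = measure M (space M)"

text \<open>The integral over the closed interval \<open>{0..x}\<close> includes a possible atom at \<open>0\<close>;
  \<open>\<phi>\<close> is a function on \<open>[0, l]\<close>, which is rendered by extensionality.\<close>

definition string_solution :: "real \<Rightarrow> real measure \<Rightarrow> complex \<Rightarrow> (real \<Rightarrow> complex) \<Rightarrow> bool" where
  "string_solution l M z \<phi> \<longleftrightarrow>
     \<phi> \<in> extensional {0..l} \<and> continuous_on {0..l} \<phi> \<and>
     (\<forall>x\<in>{0..l}. \<phi> x = 1 - z\<^sup>2 * (LINT s:{0..x}|M. complex_of_real (x - s) * \<phi> s))"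

definition string_phi :: "real \<Rightarrow> real measure \<Rightarrow> complex \<Rightarrow> real \<Rightarrow> complex" where
  "string_phi l M z = (THE \<phi>. string_solution l M z \<phi>)"

definition string_F :: "real \<Rightarrow> real measure \<Rightarrow> complex \<Rightarrow> complex" where
  "string_F l M z = string_phi l M z l - \<i> * z * (LINT s:{0..l}|M. string_phi l M z s)"

definition quasi_eigenvalues :: "real \<Rightarrow> real measure \<Rightarrow> complex set" where
  "quasi_eigenvalues l M = {z. string_F l M z = 0}"

definition admissible :: "real \<Rightarrow> real \<Rightarrow> real measure set" where
  "admissible l m = {M. is_string l M \<and> total_mass M \<le> m}"

definition admissible_quasi_eigenvalues :: "real \<Rightarrow> real \<Rightarrow> complex set" where
  "admissible_quasi_eigenvalues l m = (\<Union>M\<in>admissible l m. quasi_eigenvalues l M)"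

text \<open>A real infimum suffices: every quasi-eigenvalue has negative imaginary part, so the set
  below is bounded below by \<open>0\<close>.  It may be empty (classically \<open>\<beta>\<^sub>m\<^sub>i\<^sub>n = \<infinity>\<close>); then the
  value of \<open>Inf\<close> is irrelevant, since no string satisfies \<open>minimal_decay\<close> for that \<open>\<alpha>\<close>.\<close>

definition beta_min :: "real \<Rightarrow> real \<Rightarrow> real \<Rightarrow> real" where
  "beta_min l m \<alpha> =
     Inf {\<beta>. complex_of_real \<alpha> - \<i> * complex_of_real \<beta> \<in> admissible_quasi_eigenvalues l m}"

definition minimal_decay :: "real \<Rightarrow> real \<Rightarrow> real \<Rightarrow> real measure \<Rightarrow> bool" where
  "minimal_decay l m \<alpha> M \<longleftrightarrow> M \<in> admissible l m \<and>
     complex_of_real \<alpha> - \<i> * complex_of_real (beta_min l m \<alpha>) \<in> quasi_eigenvalues l M"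

definition string_supp :: "real measure \<Rightarrow> real set" where
  "string_supp M = {x \<in> space M. \<forall>U. open U \<and> x \<in> U \<longrightarrow> emeasure M (U \<inter> space M) > 0}"

text \<open>For a nonzero string the support is nonempty and compact, so its least element exists.\<close>

definition a_star :: "real \<Rightarrow> real measure \<Rightarrow> real" where
  "a_star l M = (if total_mass M \<noteq> 0 then (LEAST x. x \<in> string_supp M) else l)"

end

theory Submission
  imports Defs
begin

text \<open>A string solution satisfies \<open>\<phi> x = F + \<integral>s. H x s * \<phi> s dM\<close> with the symmetric kernel
  \<open>H x s = z\<^sup>2 * (l - max x s) + \<i> * z\<close>.  At a quasi-eigenvalue \<open>F = 0\<close>; testing with the conjugate
  of \<open>\<phi>\<close> then gives \<open>Im z < 0\<close>, so \<open>\<beta>\<^sub>m\<^sub>i\<^sub>n\<close> is a genuine infimum, and testing with \<open>\<phi>\<close> expresses \<open>F\<close>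
  for any competing string at any \<open>z'\<close> as a double integral of the difference of the two kernels.

  Suppose the string has mass less than \<open>m\<close> and vanishes near \<open>0\<close>.  For \<open>\<alpha> = 0\<close>, stretching it towards
  \<open>0\<close> divides the quasi-eigenvalue by a factor greater than \<open>1\<close>.  For \<open>\<alpha> \<noteq> 0\<close>, change the mass density
  (parameter \<open>\<kappa>\<close>) and move the masses (parameter \<open>\<delta>\<close>) near the left end \<open>a > 0\<close> of the support, where
  \<open>\<phi>\<close> is close to \<open>1\<close>: to first order \<open>F\<close> changes by a multiple of \<open>\<kappa> * G - z\<^sup>2 * \<delta> * C\<close> with \<open>G\<close> and \<open>C\<close>
  nearly positive.  As \<open>z\<^sup>2\<close> is not real, the two directions span the complex plane over the reals, and
  Brouwer's theorem yields a zero at \<open>z + \<i> * \<eta>\<close> for small \<open>\<eta> > 0\<close>, which contradicts minimality.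
  No simplicity of the zero is needed.\<close>

text \<open>Minimality supplies one zero of F and says nothing about its multiplicity, so a zero
  cannot simply be followed as the string varies. The roles are exchanged: the target
  \<open>\<omega> + \<i> * \<eta>\<close> is prescribed on the vertical line of the given frequency,
  and the two real parameters are solved for. One complex equation needs two real directions with
  different arguments. A change of density contributes a nearly positive number, a displacement
  contributes such a number times \<open>- \<omega>\<^sup>2\<close>; for a zero in the lower half
  plane these are independent exactly when the frequency is nonzero, whence the separate scaling
  argument for frequency zero. The solution of the two equations dictates the signs of the
  parameters, so the string must be free both to gain mass and to move masses to the left. The
  failure of (i) and (ii) grants precisely these two freedoms. A general measure may have atoms and
  singular parts. All competitors are therefore pulled back to the original measure, where only
  kernels vary; the duality identity is exact there, and Gronwall bounds suffice for the
  remainder.\<close>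

subsection \<open>Volterra equations on a string\<close>

text \<open>An exponential weight makes the Volterra kernel gain a factor \<open>1 / k\<close>. Both
  the Gronwall inequality and the contraction used for existence rest on this.\<close>

lemma max_0_mult_exp_le:
  fixes k d :: real
  assumes k: "0 < k"
  shows "max 0 d * exp (- (k * d)) \<le> 1 / k"
proof (cases "d \<le> 0")
  case False
  have "k * d \<le> exp (k * d)" using exp_ge_add_one_self[of "k * d"] by linarith
  then have "k * d * exp (- (k * d)) \<le> exp (k * d) * exp (- (k * d))"
    by (intro mult_right_mono) auto
  then have "k * d * exp (- (k * d)) \<le> 1" by (simp flip: exp_add)
  then show ?thesis using False k by (simp add: field_simps)
qed (use k in auto)

text \<open>In the supremum norm with weight \<open>exp (- (\<kappa> * \<rho> x))\<close> the
  integral operator has norm at most 1/2, so the weighted supremum \<open>S\<close> satisfies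
  \<open>S \<le> e + S / 2\<close>. The bound \<open>B\<close> serves to make \<open>S\<close>
  finite and does not enter the estimate. The abstract \<rho> allows the inequality to be run from
  either end of the string.\<close>

lemma gronwall_volterra:
  fixes v \<rho> :: "'a \<Rightarrow> real"
  assumes "finite_measure M"
    and [measurable]: "v \<in> borel_measurable M" "\<rho> \<in> borel_measurable M"
    and rho: "\<And>x. x \<in> space M \<Longrightarrow> 0 \<le> \<rho> x"
    and bdd: "\<And>x. x \<in> space M \<Longrightarrow> 0 \<le> v x" "\<And>x. x \<in> space M \<Longrightarrow> v x \<le> B"
    and c: "0 \<le> c" and e: "0 \<le> e"
    and ineq: "\<And>x. x \<in> space M \<Longrightarrow> v x \<le> e + c * (\<integral>s. max 0 (\<rho> x - \<rho> s) * v s \<partial>M)"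
    and x0: "x0 \<in> space M"
  shows "v x0 \<le> 2 * e * exp ((2 * c * measure M (space M) + 1) * \<rho> x0)"
proof -
  interpret finite_measure M by fact
  define \<mu> where "\<mu> = measure M (space M)"
  \<comment> \<open>The operator norm is at most \<open>c * \<mu> / \<kappa>\<close>, hence the
    factor 2; the summand 1 keeps \<kappa> positive when \<open>c * \<mu> = 0\<close>.\<close>
  define \<kappa> where "\<kappa> = 2 * c * \<mu> + 1"
  define S where "S = (SUP x\<in>space M. v x * exp (- (\<kappa> * \<rho> x)))"
  have mu: "0 \<le> \<mu>" by (simp add: \<mu>_def)
  have k: "0 < \<kappa>" using c mu by (simp add: \<kappa>_def add_nonneg_pos)
  have ne: "space M \<noteq> {}" using x0 by auto
  have bd: "bdd_above ((\<lambda>x. v x * exp (- (\<kappa> * \<rho> x))) ` space M)"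
  proof (rule bdd_aboveI2)
    fix x assume x: "x \<in> space M"
    have "v x * exp (- (\<kappa> * \<rho> x)) \<le> v x * 1"
      using bdd(1)[OF x] rho[OF x] k by (intro mult_left_mono) auto
    then show "v x * exp (- (\<kappa> * \<rho> x)) \<le> B" using bdd(2)[OF x] by simp
  qed
  have vS: "v x \<le> S * exp (\<kappa> * \<rho> x)" if x: "x \<in> space M" for x
  proof -
    have "v x * exp (- (\<kappa> * \<rho> x)) \<le> S" unfolding S_def by (rule cSUP_upper[OF x bd])
    then have "v x * exp (- (\<kappa> * \<rho> x)) * exp (\<kappa> * \<rho> x) \<le> S * exp (\<kappa> * \<rho> x)"
      by (intro mult_right_mono) auto
    then show ?thesis by (simp add: mult.assoc flip: exp_add)
  qed
  have S0: "0 \<le> S"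
    using vS[OF x0] bdd(1)[OF x0] by (smt (verit) exp_gt_zero mult_neg_pos)
  have texp: "max 0 d * exp (\<kappa> * - d) \<le> 1 / \<kappa>" for d :: real
    using max_0_mult_exp_le[OF k, of d] by simp
  have step: "v x * exp (- (\<kappa> * \<rho> x)) \<le> e + S / 2" if x: "x \<in> space M" for x
  proof -
    have "(\<integral>s. max 0 (\<rho> x - \<rho> s) * v s \<partial>M) \<le> (\<integral>s. exp (\<kappa> * \<rho> x) * S / \<kappa> \<partial>M)"
    proof (rule integral_mono_AE')
      show "AE s in M. max 0 (\<rho> x - \<rho> s) * v s \<le> exp (\<kappa> * \<rho> x) * S / \<kappa>"
      proof (rule AE_I2)
        fix s assume s: "s \<in> space M"
        have "max 0 (\<rho> x - \<rho> s) * v s \<le> max 0 (\<rho> x - \<rho> s) * (S * exp (\<kappa> * \<rho> s))"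
          using vS[OF s] by (intro mult_left_mono) auto
        also have "\<dots> = (max 0 (\<rho> x - \<rho> s) * exp (\<kappa> * - (\<rho> x - \<rho> s))) * (exp (\<kappa> * \<rho> x) * S)"
          by (simp add: right_diff_distrib exp_diff)
        also have "\<dots> \<le> 1 / \<kappa> * (exp (\<kappa> * \<rho> x) * S)"
          using S0 by (intro mult_right_mono texp) auto
        finally show "max 0 (\<rho> x - \<rho> s) * v s \<le> exp (\<kappa> * \<rho> x) * S / \<kappa>" by simp
      qed
      show "AE s in M. 0 \<le> exp (\<kappa> * \<rho> x) * S / \<kappa>"
        using S0 k by simp
    qed simp
    also have "\<dots> = \<mu> * (exp (\<kappa> * \<rho> x) * S / \<kappa>)" by (simp add: \<mu>_def)
    finally have "v x \<le> e + c * (\<mu> * (exp (\<kappa> * \<rho> x) * S / \<kappa>))"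
      using ineq[OF x] mult_left_mono[OF _ c] by (meson add_left_mono order_trans)
    also have "c * (\<mu> * (exp (\<kappa> * \<rho> x) * S / \<kappa>)) = (c * \<mu> / \<kappa>) * (exp (\<kappa> * \<rho> x) * S)" by simp
    also have "\<dots> \<le> (1/2) * (exp (\<kappa> * \<rho> x) * S)"
      using k S0 by (intro mult_right_mono) (auto simp: \<kappa>_def divide_simps)
    finally have "v x * exp (- (\<kappa> * \<rho> x)) \<le> (e + (1/2) * (exp (\<kappa> * \<rho> x) * S)) * exp (- (\<kappa> * \<rho> x))"
      by (intro mult_right_mono) auto
    also have "\<dots> = e * exp (- (\<kappa> * \<rho> x)) + S / 2"
      by (simp add: algebra_simps flip: exp_add)
    also have "\<dots> \<le> e * 1 + S / 2"
      using e k rho[OF x] by (intro add_right_mono mult_left_mono) auto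
    finally show ?thesis by simp
  qed
  have "S \<le> e + S / 2" unfolding S_def
    by (rule cSUP_least[OF ne]) (use step in \<open>simp add: S_def\<close>)
  then have "S \<le> 2 * e" by simp
  then have "v x0 \<le> 2 * e * exp (\<kappa> * \<rho> x0)"
    using vS[OF x0] by (smt (verit) exp_gt_zero mult_right_mono)
  then show ?thesis by (simp add: \<kappa>_def \<mu>_def)
qed

section \<open>Strings as finite measures on an interval; existence and uniqueness of the
  solution\<close>

locale krein_string =
  fixes l :: real and M :: "real measure"
  assumes l_pos: "0 < l" and is_str: "is_string l M"
begin

lemma sets_M [measurable_cong]: "sets M = sets (restrict_space borel {0..l})"
  using is_str by (simp add: is_string_def)

lemma space_M [simp]: "space M = {0..l}"
  using sets_eq_imp_space_eq[OF sets_M] by (simp add: space_restrict_space)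

sublocale finite_measure M
  using is_str by (simp add: is_string_def)

lemma measurable_continuous:
  fixes f :: "real \<Rightarrow> 'b::topological_space"
  assumes "continuous_on {0..l} f"
  shows "f \<in> borel_measurable M"
  using borel_measurable_continuous_on_restrict[OF assms] measurable_cong_sets[OF sets_M refl] by blast

lemma measurable_M_ident [measurable]: "(\<lambda>x. x) \<in> borel_measurable M"
  by (intro measurable_continuous continuous_intros)

lemma bounded_continuous:
  fixes f :: "real \<Rightarrow> 'b::real_normed_vector"
  assumes "continuous_on {0..l} f"
  obtains B where "0 < B" "\<And>x. x \<in> {0..l} \<Longrightarrow> norm (f x) \<le> B"
proof -
  have "bounded (f ` {0..l})"
    by (intro compact_imp_bounded compact_continuous_image assms) auto
  then show ?thesis using that unfolding bounded_pos by auto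
qed

lemma integrable_continuous:
  fixes f :: "real \<Rightarrow> 'b::{banach, second_countable_topology}"
  assumes "continuous_on {0..l} f"
  shows "integrable M f"
proof -
  obtain B where "\<And>x. x \<in> {0..l} \<Longrightarrow> norm (f x) \<le> B"
    using bounded_continuous[OF assms] by blast
  then show ?thesis
    by (intro integrable_const_bound[of _ B] measurable_continuous assms AE_I2) auto
qed

lemma norm_integral_le:
  fixes f :: "real \<Rightarrow> 'b::{banach, second_countable_topology}"
  assumes "\<And>x. x \<in> {0..l} \<Longrightarrow> norm (f x) \<le> B" "0 \<le> B"
  shows "norm (\<integral>x. f x \<partial>M) \<le> measure M {0..l} * B"
proof -
  have "norm (\<integral>x. f x \<partial>M) \<le> (\<integral>x. norm (f x) \<partial>M)" by (rule integral_norm_bound)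
  also have "\<dots> \<le> (\<integral>x. B \<partial>M)"
    using assms by (intro integral_mono_AE' AE_I2) auto
  finally show ?thesis by simp
qed

text \<open>The factor \<open>x - s\<close> vanishes at the moving endpoint, so the cut at
  \<open>x\<close> can be absorbed into the continuous kernel \<open>max 0 (x - s)\<close>. An atom
  at \<open>x\<close> then causes no jump.\<close>

lemma string_solution_iff:
  "string_solution l M z \<phi> \<longleftrightarrow> \<phi> \<in> extensional {0..l} \<and> continuous_on {0..l} \<phi> \<and>
     (\<forall>x\<in>{0..l}. \<phi> x = 1 - z\<^sup>2 * (\<integral>s. complex_of_real (max 0 (x - s)) * \<phi> s \<partial>M))"
proof -
  have "(LINT s:{0..x}|M. complex_of_real (x - s) * \<phi> s)
      = (\<integral>s. complex_of_real (max 0 (x - s)) * \<phi> s \<partial>M)" if "x \<in> {0..l}" for x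
    unfolding set_lebesgue_integral_def
    by (rule Bochner_Integration.integral_cong) (auto simp: indicator_def max_def)
  then show ?thesis unfolding string_solution_def by auto
qed

lemma volterra_unique:
  fixes \<phi> \<psi> :: "real \<Rightarrow> complex"
  assumes "continuous_on {0..l} \<phi>" "continuous_on {0..l} \<psi>" "x \<in> {0..l}"
    and "\<And>x. x \<in> {0..l} \<Longrightarrow> \<phi> x = 1 - z\<^sup>2 * (\<integral>s. complex_of_real (max 0 (x - s)) * \<phi> s \<partial>M)"
    and "\<And>x. x \<in> {0..l} \<Longrightarrow> \<psi> x = 1 - z\<^sup>2 * (\<integral>s. complex_of_real (max 0 (x - s)) * \<psi> s \<partial>M)"
  shows "\<phi> x = \<psi> x"
proof -
  obtain B where B: "\<And>x. x \<in> {0..l} \<Longrightarrow> norm (\<phi> x - \<psi> x) \<le> B"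
    using bounded_continuous[OF continuous_on_diff[OF assms(1,2)]] by blast
  have "norm (\<phi> x - \<psi> x) \<le> 2 * 0 * exp ((2 * norm (z\<^sup>2) * measure M (space M) + 1) * x)"
  proof (rule gronwall_volterra[where B = B and \<rho> = "\<lambda>x. x" and v = "\<lambda>x. norm (\<phi> x - \<psi> x)"])
    show "(\<lambda>x. norm (\<phi> x - \<psi> x)) \<in> borel_measurable M"
      by (intro measurable_continuous continuous_intros assms)
    fix x assume "x \<in> space M"
    then have x: "x \<in> {0..l}" by simp
    have "\<phi> x - \<psi> x = - z\<^sup>2 * ((\<integral>s. complex_of_real (max 0 (x - s)) * \<phi> s \<partial>M)
         - (\<integral>s. complex_of_real (max 0 (x - s)) * \<psi> s \<partial>M))"
      using assms(4)[OF x] assms(5)[OF x] by (simp add: algebra_simps)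
    also have "\<dots> = - z\<^sup>2 * (\<integral>s. complex_of_real (max 0 (x - s)) * (\<phi> s - \<psi> s) \<partial>M)"
      by (subst Bochner_Integration.integral_diff[symmetric])
        (auto intro!: integrable_continuous continuous_intros assms simp: algebra_simps)
    finally have "norm (\<phi> x - \<psi> x)
        = norm (z\<^sup>2) * norm (\<integral>s. complex_of_real (max 0 (x - s)) * (\<phi> s - \<psi> s) \<partial>M)"
      by (simp add: norm_mult)
    also have "\<dots> \<le> norm (z\<^sup>2) * (\<integral>s. norm (complex_of_real (max 0 (x - s)) * (\<phi> s - \<psi> s)) \<partial>M)"
      by (intro mult_left_mono integral_norm_bound) auto
    finally show "norm (\<phi> x - \<psi> x) \<le> 0 + norm (z\<^sup>2) * (\<integral>s. max 0 (x - s) * norm (\<phi> s - \<psi> s) \<partial>M)"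
      by (simp add: norm_mult)
  qed (use B assms(3) in \<open>auto intro: finite_measure_axioms\<close>)
  then show ?thesis by simp
qed


text \<open>The kernel is 1-Lipschitz in \<open>x\<close> uniformly in \<open>s\<close>, so the
  integral is Lipschitz for every finite measure, with or without atoms.\<close>

lemma continuous_on_kernel_integral:
  fixes g :: "real \<Rightarrow> complex"
  assumes g: "continuous_on {0..l} g"
  shows "continuous_on UNIV (\<lambda>x. \<integral>s. complex_of_real (max 0 (x - s)) * g s \<partial>M)"
proof -
  obtain B where B: "0 < B" "\<And>x. x \<in> {0..l} \<Longrightarrow> norm (g x) \<le> B"
    using bounded_continuous[OF g] by blast
  show ?thesis
  proof (rule lipschitz_on_continuous_on[OF lipschitz_onI])
    fix x y :: real
    have "(\<integral>s. complex_of_real (max 0 (x - s)) * g s \<partial>M)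
          - (\<integral>s. complex_of_real (max 0 (y - s)) * g s \<partial>M)
        = (\<integral>s. complex_of_real (max 0 (x - s)) * g s - complex_of_real (max 0 (y - s)) * g s \<partial>M)"
      by (subst Bochner_Integration.integral_diff)
        (auto intro!: integrable_continuous continuous_intros g)
    also have "norm \<dots> \<le> measure M {0..l} * (\<bar>x - y\<bar> * B)"
    proof (rule norm_integral_le)
      fix s assume s: "s \<in> {0..l}"
      have "norm (complex_of_real (max 0 (x - s)) * g s - complex_of_real (max 0 (y - s)) * g s)
          = \<bar>max 0 (x - s) - max 0 (y - s)\<bar> * norm (g s)"
        unfolding left_diff_distrib[symmetric] of_real_diff[symmetric] norm_mult norm_of_real ..
      also have "\<dots> \<le> \<bar>x - y\<bar> * B"
        using B(2)[OF s] by (intro mult_mono) auto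
      finally show "norm (complex_of_real (max 0 (x - s)) * g s - complex_of_real (max 0 (y - s)) * g s)
        \<le> \<bar>x - y\<bar> * B" .
    qed (use B in auto)
    finally show "dist (\<integral>s. complex_of_real (max 0 (x - s)) * g s \<partial>M)
          (\<integral>s. complex_of_real (max 0 (y - s)) * g s \<partial>M) \<le> (measure M {0..l} * B) * dist x y"
      by (simp add: dist_norm mult_ac)
  qed (use B in auto)
qed

text \<open>In the unknown \<open>exp (- k x) * \<phi> x\<close> with \<open>k\<close> large, the Volterra operator is a contraction
  for the supremum norm.\<close>

lemma string_solution_exists: "\<exists>\<phi>. string_solution l M z \<phi>"
proof -
  define \<mu> where "\<mu> = measure M {0..l}"
  \<comment> \<open>This makes the contraction factor \<open>norm (z\<^sup>2) * \<mu> / k\<close> at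
    most 1/2.\<close>
  define k where "k = 2 * norm (z\<^sup>2) * \<mu> + 1"
  have mu: "0 \<le> \<mu>" by (simp add: \<mu>_def)
  have k: "0 < k" using mu by (simp add: k_def add_nonneg_pos)
  \<comment> \<open>The fixed point is sought among bounded continuous functions on the whole line.
    Clamping the argument makes \<open>T g\<close> bounded there and changes nothing on
    \<open>{0..l}\<close>.\<close>
  define cl where "cl x = max 0 (min l x)" for x :: real
  have cl: "cl x \<in> {0..l}" for x using l_pos by (auto simp: cl_def)
  define I where "I g x = (\<integral>s. complex_of_real (max 0 (x - s)) * (complex_of_real (exp (k * s)) * g s) \<partial>M)"
    for g :: "real \<Rightarrow> complex" and x
  define T where "T g x = complex_of_real (exp (- (k * cl x))) * (1 - z\<^sup>2 * I g (cl x))"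
    for g :: "real \<Rightarrow> complex" and x
  have contI: "continuous_on UNIV (I g)" if "continuous_on {0..l} g" for g
    unfolding I_def by (intro continuous_on_kernel_integral continuous_intros that)
  have contT: "continuous_on UNIV (T g)" if "continuous_on {0..l} g" for g
  proof -
    have "continuous_on UNIV (\<lambda>x. I g (cl x))"
      by (rule continuous_on_compose2[OF contI[OF that]]) (auto simp: cl_def intro!: continuous_intros)
    moreover have "continuous_on UNIV cl" by (auto simp: cl_def[abs_def] intro!: continuous_intros)
    ultimately show ?thesis unfolding T_def by (intro continuous_intros)
  qed
  have T_bc: "T (apply_bcontfun g) \<in> bcontfun" for g
  proof -
    have c: "continuous_on UNIV (T g)" by (rule contT) auto
    obtain B where B: "\<And>x. x \<in> {0..l} \<Longrightarrow> norm (T g x) \<le> B"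
      using bounded_continuous[OF continuous_on_subset[OF c]] by blast
    have "cl (cl x) = cl x" for x using l_pos by (auto simp: cl_def)
    then have "T g x = T g (cl x)" for x by (simp add: T_def)
    then have "norm (T g x) \<le> B" for x using B[OF cl] by metis
    then show ?thesis by (rule bcontfun_normI[OF c])
  qed
  define TT where "TT g = Bcontfun (T (apply_bcontfun g))" for g
  have TT: "apply_bcontfun (TT g) = T g" for g
    unfolding TT_def by (rule Bcontfun_inverse[OF T_bc])
  note texp = max_0_mult_exp_le[OF k]
  have "\<exists>!g. TT g = g"
  proof (rule banach_fix_type[where c = "1/2"])
    show "\<forall>f g. dist (TT f) (TT g) \<le> 1 / 2 * dist f g"
    proof (intro allI dist_bound)
      fix f g :: "(real, complex) bcontfun" and x0 :: real
      define x where "x = cl x0"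
      have "I f x - I g x = (\<integral>s. complex_of_real (max 0 (x - s)) * (complex_of_real (exp (k * s)) * (f s - g s)) \<partial>M)"
        unfolding I_def
        by (subst Bochner_Integration.integral_diff[symmetric])
          (auto intro!: integrable_continuous continuous_intros simp: algebra_simps)
      then have "complex_of_real (exp (- (k * x))) * (I f x - I g x)
          = (\<integral>s. complex_of_real (exp (- (k * x))) * (complex_of_real (max 0 (x - s)) * (complex_of_real (exp (k * s)) * (f s - g s))) \<partial>M)"
        by simp
      also have "norm \<dots> \<le> measure M {0..l} * ((1 / k) * dist f g)"
      proof (rule norm_integral_le)
        fix s
        have "norm (complex_of_real (exp (- (k * x))) * (complex_of_real (max 0 (x - s)) * (complex_of_real (exp (k * s)) * (f s - g s))))
           = max 0 (x - s) * (exp (- (k * x)) * exp (k * s)) * norm (f s - g s)"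
          by (simp add: norm_mult)
        also have "exp (- (k * x)) * exp (k * s) = exp (- (k * (x - s)))"
          by (simp add: algebra_simps flip: exp_add)
        also have "max 0 (x - s) * exp (- (k * (x - s))) * norm (f s - g s) \<le> (1 / k) * dist f g"
          using dist_bounded[of f s g] k by (intro mult_mono texp) (auto simp: dist_norm)
        finally show "norm (complex_of_real (exp (- (k * x))) * (complex_of_real (max 0 (x - s)) * (complex_of_real (exp (k * s)) * (f s - g s))))
           \<le> (1 / k) * dist f g" .
      qed (use k in auto)
      finally have *: "norm (complex_of_real (exp (- (k * x))) * (I f x - I g x)) \<le> \<mu> * ((1 / k) * dist f g)"
        unfolding \<mu>_def .
      have "T f x0 - T g x0 = - (z\<^sup>2) * (complex_of_real (exp (- (k * x))) * (I f x - I g x))"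
        by (simp add: T_def x_def algebra_simps)
      then have "dist (TT f x0) (TT g x0) = norm (z\<^sup>2) * norm (complex_of_real (exp (- (k * x))) * (I f x - I g x))"
        by (simp add: TT dist_norm norm_mult)
      also have "\<dots> \<le> norm (z\<^sup>2) * (\<mu> * ((1 / k) * dist f g))"
        by (intro mult_left_mono *) auto
      also have "\<dots> = (norm (z\<^sup>2) * \<mu> / k) * dist f g" by simp
      also have "\<dots> \<le> 1 / 2 * dist f g"
        using k by (intro mult_right_mono) (auto simp: k_def divide_simps)
      finally show "dist (TT f x0) (TT g x0) \<le> 1 / 2 * dist f g" .
    qed
  qed auto
  then obtain g where g: "TT g = g" by blast
  have gT: "g x = T g x" for x using TT[of g] g by simp
  define \<phi> where "\<phi> = (\<lambda>x. complex_of_real (exp (k * x)) * g x)"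
  have "\<phi> x = 1 - z\<^sup>2 * (\<integral>s. complex_of_real (max 0 (x - s)) * \<phi> s \<partial>M)" if "x \<in> {0..l}" for x
  proof -
    have [simp]: "cl x = x" using that by (auto simp: cl_def)
    have "\<phi> x = complex_of_real (exp (k * x) * exp (- (k * x))) * (1 - z\<^sup>2 * I g x)"
      unfolding \<phi>_def by (subst gT) (simp add: T_def del: of_real_exp)
    then show ?thesis by (simp add: I_def \<phi>_def flip: exp_add)
  qed
  moreover have "continuous_on {0..l} \<phi>" unfolding \<phi>_def by (intro continuous_intros) auto
  moreover have "(\<integral>s. complex_of_real (max 0 (x - s)) * restrict \<phi> {0..l} s \<partial>M)
      = (\<integral>s. complex_of_real (max 0 (x - s)) * \<phi> s \<partial>M)" for x
    by (rule Bochner_Integration.integral_cong) auto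
  moreover have "continuous_on {0..l} (restrict \<phi> {0..l}) \<longleftrightarrow> continuous_on {0..l} \<phi>"
    by (rule continuous_on_cong) auto
  ultimately have "string_solution l M z (restrict \<phi> {0..l})"
    unfolding string_solution_iff by simp
  then show ?thesis by blast
qed

lemma string_solution_unique:
  assumes "string_solution l M z \<phi>" "string_solution l M z \<psi>"
  shows "\<phi> = \<psi>"
proof (rule extensionalityI)
  show "\<phi> \<in> extensional {0..l}" "\<psi> \<in> extensional {0..l}"
    using assms by (simp_all add: string_solution_iff)
  fix x assume "x \<in> {0..l}"
  then show "\<phi> x = \<psi> x"
    by (rule volterra_unique[where z = z, rotated 2]) (use assms in \<open>simp_all add: string_solution_iff\<close>)
qed

lemma string_solution_string_phi: "string_solution l M z (string_phi l M z)"
proof -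
  have "\<exists>!\<phi>. string_solution l M z \<phi>"
    using string_solution_exists string_solution_unique by blast
  then show ?thesis unfolding string_phi_def by (rule theI')
qed

lemma continuous_on_string_phi [continuous_intros]: "continuous_on {0..l} (string_phi l M z)"
  using string_solution_string_phi[of z] by (simp add: string_solution_iff)

lemma measurable_string_phi [measurable]: "string_phi l M z \<in> borel_measurable M"
  by (intro measurable_continuous continuous_intros)

lemma string_phi_eq:
  "x \<in> {0..l} \<Longrightarrow> string_phi l M z x
     = 1 - z\<^sup>2 * (\<integral>s. complex_of_real (max 0 (x - s)) * string_phi l M z s \<partial>M)"
  using string_solution_string_phi[of z] by (simp add: string_solution_iff)

lemma string_phi_0: "string_phi l M z 0 = 1"
proof -
  have "(\<integral>s. complex_of_real (max 0 (0 - s)) * string_phi l M z s \<partial>M) = (\<integral>s. 0 \<partial>M)"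
    by (rule Bochner_Integration.integral_cong) auto
  then show ?thesis using string_phi_eq[of 0 z] l_pos by simp
qed

end

text \<open>For nonzero z this is \<open>z\<^sup>2\<close> times the Green function of
  \<open>- u''\<close> on \<open>{0..l}\<close> with \<open>u' = 0\<close> at the left end and the
  radiation condition \<open>u' = \<i> * z * u\<close> at \<open>l\<close>, the condition that
  \<open>F = 0\<close> imposes on \<phi>. The factor is multiplied in, so that no division by z
  occurs.\<close>

definition green_kernel :: "real \<Rightarrow> complex \<Rightarrow> real \<Rightarrow> real \<Rightarrow> complex" where
  "green_kernel l z x s = z\<^sup>2 * complex_of_real (l - max x s) + \<i> * z"

lemma green_kernel_commute: "green_kernel l z x s = green_kernel l z s x"
  by (simp add: green_kernel_def max.commute)

context krein_string begin

lemma string_F_eq: "string_F l M z = string_phi l M z l - \<i> * z * (\<integral>s. string_phi l M z s \<partial>M)"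
proof -
  have "(LINT s:{0..l}|M. string_phi l M z s) = (\<integral>s. string_phi l M z s \<partial>M)"
    unfolding set_lebesgue_integral_def by (rule Bochner_Integration.integral_cong) auto
  then show ?thesis by (simp add: string_F_def)
qed

text \<open>Subtract the Volterra equations at \<open>x\<close> and at \<open>l\<close>: on the
  interval, \<open>(l - s) - max 0 (x - s) = l - max x s\<close>. The term \<open>\<i> * z\<close>
  in the kernel turns the remaining \<open>\<phi> l\<close> into \<open>F\<close>.\<close>

lemma string_phi_eq_green:
  assumes x: "x \<in> {0..l}"
  shows "string_phi l M z x = string_F l M z + (\<integral>s. green_kernel l z x s * string_phi l M z s \<partial>M)"
proof -
  let ?\<phi> = "string_phi l M z"
  let ?A = "\<integral>s. complex_of_real (max 0 (l - s)) * ?\<phi> s \<partial>M"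
  let ?B = "\<integral>s. complex_of_real (max 0 (x - s)) * ?\<phi> s \<partial>M"
  let ?C = "\<integral>s. ?\<phi> s \<partial>M"
  have "(\<integral>s. green_kernel l z x s * ?\<phi> s \<partial>M)
     = (\<integral>s. z\<^sup>2 * (complex_of_real (max 0 (l - s)) * ?\<phi> s) - z\<^sup>2 * (complex_of_real (max 0 (x - s)) * ?\<phi> s)
          + \<i> * z * ?\<phi> s \<partial>M)"
    by (rule Bochner_Integration.integral_cong)
      (use x in \<open>auto simp: green_kernel_def max_def algebra_simps\<close>)
  also have "\<dots> = z\<^sup>2 * ?A - z\<^sup>2 * ?B + \<i> * z * ?C"
    by (simp add: integrable_continuous continuous_intros)
  finally have "(\<integral>s. green_kernel l z x s * ?\<phi> s \<partial>M) = z\<^sup>2 * ?A - z\<^sup>2 * ?B + \<i> * z * ?C" .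
  moreover have "?\<phi> x = 1 - z\<^sup>2 * ?B" by (rule string_phi_eq[OF x])
  moreover have "?\<phi> l = 1 - z\<^sup>2 * ?A" by (rule string_phi_eq) (use l_pos in auto)
  ultimately show ?thesis unfolding string_F_eq by (simp only:) simp
qed

end

subsection \<open>Sign of the imaginary part\<close>

lemma integrable_pair_bounded:
  fixes f :: "'a \<times> 'b \<Rightarrow> 'c::{banach, second_countable_topology}"
  assumes "finite_measure M1" "finite_measure M2" "f \<in> borel_measurable (M1 \<Otimes>\<^sub>M M2)"
    and "\<And>x y. x \<in> space M1 \<Longrightarrow> y \<in> space M2 \<Longrightarrow> norm (f (x, y)) \<le> B"
  shows "integrable (M1 \<Otimes>\<^sub>M M2) f"
proof -
  interpret finite_measure "M1 \<Otimes>\<^sub>M M2"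
    by (rule finite_measure_pair_measure) fact+
  show ?thesis
    using assms by (intro integrable_const_bound[where B = B]) (auto simp: space_pair_measure)
qed

lemma Fubini_bounded:
  fixes f :: "'a \<Rightarrow> 'b \<Rightarrow> 'c::{banach, second_countable_topology}"
  assumes "finite_measure M1" "finite_measure M2" "case_prod f \<in> borel_measurable (M1 \<Otimes>\<^sub>M M2)"
    and "\<And>x y. x \<in> space M1 \<Longrightarrow> y \<in> space M2 \<Longrightarrow> norm (f x y) \<le> B"
  shows "(\<integral>x. (\<integral>y. f x y \<partial>M2) \<partial>M1) = (\<integral>y. (\<integral>x. f x y \<partial>M1) \<partial>M2)"
proof -
  interpret M1: finite_measure M1 by fact
  interpret M2: finite_measure M2 by fact
  interpret pair_sigma_finite M1 M2 ..
  show ?thesis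
    by (rule Fubini_integral[symmetric], rule integrable_pair_bounded[where B = B]) (use assms in auto)
qed

context krein_string begin

text \<open>The quadratic form is the integral over \<open>t\<close> in \<open>{0..l}\<close> of the squared modulus of
  \<open>\<integral>s\<le>t. \<phi> s dM\<close>, because \<open>l - max s r\<close> is the length of the set of all \<open>t\<close> in \<open>{0..l}\<close>
  with \<open>s \<le> t\<close> and \<open>r \<le> t\<close>.\<close>

lemma green_form_nonneg:
  fixes \<phi> :: "real \<Rightarrow> complex"
  assumes \<phi>: "continuous_on {0..l} \<phi>"
  obtains C :: real where "0 \<le> C"
    "(\<integral>s. cnj (\<phi> s) * (\<integral>r. complex_of_real (l - max s r) * \<phi> r \<partial>M) \<partial>M) = complex_of_real C"
proof -
  define N where "N = restrict_space lborel {0..l}"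
  have emN: "emeasure N A = emeasure lborel A" if "A \<subseteq> {0..l}" for A
    unfolding N_def by (rule emeasure_restrict_space) (use that in auto)
  have spN [simp]: "space N = {0..l}" by (simp add: N_def space_restrict_space)
  interpret N: finite_measure N
    by standard (use emN[of "{0..l}"] l_pos in \<open>auto simp: emeasure_lborel_Icc_eq\<close>)
  have setsN: "sets N = sets (restrict_space borel {0..l})"
    unfolding N_def by (rule sets_restrict_space_cong) simp
  have [measurable]: "(\<lambda>x. x) \<in> borel_measurable N"
    unfolding N_def by (rule measurable_restrict_space1) simp
  have [measurable]: "\<phi> \<in> borel_measurable M" by (rule measurable_continuous[OF \<phi>])
  have [measurable]: "(\<lambda>s. cnj (\<phi> s)) \<in> borel_measurable M"
    by (intro measurable_continuous continuous_intros \<phi>)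
  obtain B where B: "0 < B" "\<And>x. x \<in> {0..l} \<Longrightarrow> norm (\<phi> x) \<le> B"
    using bounded_continuous[OF \<phi>] by blast
  define i where "i s t = (if s \<le> t then 1 else 0 :: complex)" for s t :: real
  have i_le: "norm (i s t) \<le> 1" for s t by (simp add: i_def)
  define \<Phi> where "\<Phi> t = (\<integral>s. i s t * \<phi> s \<partial>M)" for t
  have [measurable]: "(\<lambda>(t, s). i s t) \<in> borel_measurable (N \<Otimes>\<^sub>M M)"
    unfolding i_def split_beta by measurable
  have [measurable]: "(\<lambda>(s, t). i s t) \<in> borel_measurable (M \<Otimes>\<^sub>M N)"
    unfolding i_def split_beta by measurable
  have [measurable]: "\<Phi> \<in> borel_measurable N" unfolding \<Phi>_def by measurable
  have \<Phi>_le: "norm (\<Phi> t) \<le> measure M {0..l} * B" for t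
    unfolding \<Phi>_def
    by (rule norm_integral_le) (use B mult_mono[OF i_le B(2)] in \<open>auto simp: norm_mult\<close>)
  have ii: "(\<integral>t. i s t * i r t \<partial>N) = complex_of_real (l - max s r)" if "s \<in> {0..l}" "r \<in> {0..l}" for s r
  proof -
    have "(\<integral>t. i s t * i r t \<partial>N) = (\<integral>t. complex_of_real (indicator {max s r..l} t) \<partial>N)"
      by (rule Bochner_Integration.integral_cong) (auto simp: i_def indicator_def)
    also have "\<dots> = complex_of_real (measure N {max s r..l})"
      using that by (simp add: setsN sets_restrict_space_iff Int_absorb2 max_absorb1 le_max_iff_disj)
    also have "measure N {max s r..l} = l - max s r"
      using that unfolding measure_def by (subst emN) (auto simp: max_def)
    finally show ?thesis .
  qed
  \<comment> \<open>The two factors \<Phi> are expanded one after the other, each time followed by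
    an exchange of integrations; the integral over t of the two indicators is then evaluated by
    \<open>ii\<close>.\<close>
  have "(\<integral>t. \<Phi> t * cnj (\<Phi> t) \<partial>N) = (\<integral>t. (\<integral>s. \<Phi> t * (i s t * cnj (\<phi> s)) \<partial>M) \<partial>N)"
  proof (rule Bochner_Integration.integral_cong[OF refl])
    fix t
    have "cnj (\<Phi> t) = (\<integral>s. cnj (i s t * \<phi> s) \<partial>M)"
      unfolding \<Phi>_def by (rule integral_bounded_linear'[OF bounded_linear_cnj bounded_linear_cnj, symmetric]) auto
    also have "\<dots> = (\<integral>s. i s t * cnj (\<phi> s) \<partial>M)"
      by (rule Bochner_Integration.integral_cong) (auto simp: i_def)
    finally show "\<Phi> t * cnj (\<Phi> t) = (\<integral>s. \<Phi> t * (i s t * cnj (\<phi> s)) \<partial>M)" by simp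
  qed
  also have "\<dots> = (\<integral>s. (\<integral>t. \<Phi> t * (i s t * cnj (\<phi> s)) \<partial>N) \<partial>M)"
  proof (rule Fubini_bounded)
    show "(\<lambda>(t, s). \<Phi> t * (i s t * cnj (\<phi> s))) \<in> borel_measurable (N \<Otimes>\<^sub>M M)" by measurable
    show "norm (\<Phi> t * (i s t * cnj (\<phi> s))) \<le> (measure M {0..l} * B) * (1 * B)"
      if "t \<in> space N" "s \<in> space M" for t s
      unfolding norm_mult complex_mod_cnj
      by (intro mult_mono \<Phi>_le i_le B) (use that B in auto)
  qed (auto intro: N.finite_measure_axioms finite_measure_axioms)
  also have "\<dots> = (\<integral>s. cnj (\<phi> s) * (\<integral>r. complex_of_real (l - max s r) * \<phi> r \<partial>M) \<partial>M)"
  proof (rule Bochner_Integration.integral_cong[OF refl])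
    fix s assume "s \<in> space M"
    then have s: "s \<in> {0..l}" by simp
    have [measurable]: "(\<lambda>t. i s t) \<in> borel_measurable N" unfolding i_def by measurable
    have "(\<integral>t. \<Phi> t * (i s t * cnj (\<phi> s)) \<partial>N) = cnj (\<phi> s) * (\<integral>t. \<Phi> t * i s t \<partial>N)"
      by (subst integral_mult_right_zero[symmetric]) (simp add: mult_ac)
    also have "(\<integral>t. \<Phi> t * i s t \<partial>N) = (\<integral>t. (\<integral>r. (i s t * i r t) * \<phi> r \<partial>M) \<partial>N)"
      unfolding \<Phi>_def by (simp add: mult_ac flip: integral_mult_right_zero)
    also have "\<dots> = (\<integral>r. (\<integral>t. (i s t * i r t) * \<phi> r \<partial>N) \<partial>M)"
    proof (rule Fubini_bounded)
      show "(\<lambda>(t, r). (i s t * i r t) * \<phi> r) \<in> borel_measurable (N \<Otimes>\<^sub>M M)" by measurable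
      show "norm ((i s t * i r t) * \<phi> r) \<le> (1 * 1) * B" if "t \<in> space N" "r \<in> space M" for t r
        unfolding norm_mult by (intro mult_mono i_le B) (use that B in auto)
    qed (auto intro: N.finite_measure_axioms finite_measure_axioms)
    also have "\<dots> = (\<integral>r. complex_of_real (l - max s r) * \<phi> r \<partial>M)"
    proof (rule Bochner_Integration.integral_cong[OF refl])
      fix r assume "r \<in> space M"
      then show "(\<integral>t. (i s t * i r t) * \<phi> r \<partial>N) = complex_of_real (l - max s r) * \<phi> r"
        using ii[OF s, of r] by simp
    qed
    finally show "(\<integral>t. \<Phi> t * (i s t * cnj (\<phi> s)) \<partial>N)
      = cnj (\<phi> s) * (\<integral>r. complex_of_real (l - max s r) * \<phi> r \<partial>M)" .
  qed
  finally have "(\<integral>s. cnj (\<phi> s) * (\<integral>r. complex_of_real (l - max s r) * \<phi> r \<partial>M) \<partial>M)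
      = (\<integral>t. complex_of_real ((norm (\<Phi> t))\<^sup>2) \<partial>N)"
    by (simp flip: complex_norm_square)
  also have "\<dots> = complex_of_real (\<integral>t. (norm (\<Phi> t))\<^sup>2 \<partial>N)" by (rule integral_complex_of_real)
  finally show ?thesis using that[of "\<integral>t. (norm (\<Phi> t))\<^sup>2 \<partial>N"] by simp
qed

lemma green_integral_eq:
  fixes \<phi> :: "real \<Rightarrow> complex"
  assumes "continuous_on {0..l} \<phi>"
  shows "(\<integral>s. green_kernel l z x s * \<phi> s \<partial>M)
    = z\<^sup>2 * (\<integral>s. complex_of_real (l - max x s) * \<phi> s \<partial>M) + \<i> * z * (\<integral>s. \<phi> s \<partial>M)"
proof -
  have "(\<integral>s. green_kernel l z x s * \<phi> s \<partial>M)
      = (\<integral>s. z\<^sup>2 * (complex_of_real (l - max x s) * \<phi> s) + \<i> * z * \<phi> s \<partial>M)"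
    by (rule Bochner_Integration.integral_cong) (auto simp: green_kernel_def algebra_simps)
  also have "\<dots> = z\<^sup>2 * (\<integral>s. complex_of_real (l - max x s) * \<phi> s \<partial>M) + \<i> * z * (\<integral>s. \<phi> s \<partial>M)"
    by (simp add: integrable_continuous continuous_intros assms)
  finally show ?thesis .
qed

text \<open>If the total momentum \<open>\<integral>\<phi> dM\<close> vanished, \<open>\<phi>\<close> would have zero Cauchy data at \<open>l\<close>,
  so Gronwall's inequality run from the right end would give \<open>\<phi> = 0\<close>.\<close>

lemma integral_string_phi_nonzero:
  assumes F: "string_F l M z = 0"
  shows "(\<integral>s. string_phi l M z s \<partial>M) \<noteq> 0"
proof
  let ?\<phi> = "string_phi l M z"
  assume 0: "(\<integral>s. ?\<phi> s \<partial>M) = 0"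
  obtain B where B: "\<And>x. x \<in> {0..l} \<Longrightarrow> norm (?\<phi> x) \<le> B"
    using bounded_continuous[OF continuous_on_string_phi] by blast
  have "norm (?\<phi> 0) \<le> 2 * 0 * exp ((2 * norm (z\<^sup>2) * measure M (space M) + 1) * (l - 0))"
  proof (rule gronwall_volterra[where B = B and \<rho> = "\<lambda>x. l - x" and v = "\<lambda>x. norm (?\<phi> x)"])
    fix x assume "x \<in> space M"
    then have x: "x \<in> {0..l}" by simp
    \<comment> \<open>The subtracted term is zero because the momentum vanishes. With it the kernel
      becomes \<open>- max 0 (s - x)\<close>, a Volterra kernel for the distance from the right
      end.\<close>
    have "?\<phi> x = z\<^sup>2 * (\<integral>s. complex_of_real (l - max x s) * ?\<phi> s \<partial>M)
        - z\<^sup>2 * (\<integral>s. complex_of_real (l - x) * ?\<phi> s \<partial>M)"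
      using string_phi_eq_green[OF x, of z] 0
      by (simp add: F green_integral_eq[OF continuous_on_string_phi])
    also have "\<dots> = z\<^sup>2 * (\<integral>s. complex_of_real (l - max x s) * ?\<phi> s - complex_of_real (l - x) * ?\<phi> s \<partial>M)"
      unfolding right_diff_distrib[symmetric]
      by (subst Bochner_Integration.integral_diff) (intro integrable_continuous continuous_intros refl)+
    finally have "norm (?\<phi> x) = norm (z\<^sup>2) * norm (\<integral>s. complex_of_real (l - max x s) * ?\<phi> s - complex_of_real (l - x) * ?\<phi> s \<partial>M)"
      by (simp add: norm_mult)
    also have "\<dots> \<le> norm (z\<^sup>2) * (\<integral>s. norm (complex_of_real (l - max x s) * ?\<phi> s - complex_of_real (l - x) * ?\<phi> s) \<partial>M)"
      by (intro mult_left_mono integral_norm_bound) auto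
    also have "(\<integral>s. norm (complex_of_real (l - max x s) * ?\<phi> s - complex_of_real (l - x) * ?\<phi> s) \<partial>M)
        = (\<integral>s. max 0 ((l - x) - (l - s)) * norm (?\<phi> s) \<partial>M)"
      unfolding left_diff_distrib[symmetric] of_real_diff[symmetric] norm_mult norm_of_real
      by (rule Bochner_Integration.integral_cong) auto
    finally show "norm (?\<phi> x) \<le> 0 + norm (z\<^sup>2) * (\<integral>s. max 0 ((l - x) - (l - s)) * norm (?\<phi> s) \<partial>M)"
      by simp
  qed (use B l_pos in \<open>auto intro: finite_measure_axioms\<close>)
  then show False by (simp add: string_phi_0)
qed

text \<open>With \<open>A\<close> the squared norm of \<phi>, \<open>C\<close> the nonnegative form
  and \<open>P\<close> the momentum, testing gives
  \<open>A = z\<^sup>2 * C + \<i> * z * (norm P)\<^sup>2\<close>. After multiplication by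
  \<open>cnj z\<close> the imaginary part reads \<open>Im z * (A + (norm z)\<^sup>2 * C) = - (norm
  z)\<^sup>2 * (norm P)\<^sup>2\<close>, and the right side is strictly negative because
  \<open>P\<close> does not vanish.\<close>

lemma quasi_eigenvalue_Im_neg:
  assumes F: "string_F l M z = 0"
  shows "Im z < 0"
proof -
  let ?\<phi> = "string_phi l M z"
  define P where "P = (\<integral>s. ?\<phi> s \<partial>M)"
  have P: "P \<noteq> 0" using integral_string_phi_nonzero[OF F] by (simp add: P_def)
  obtain C where C: "0 \<le> C"
    "(\<integral>s. cnj (?\<phi> s) * (\<integral>r. complex_of_real (l - max s r) * ?\<phi> r \<partial>M) \<partial>M) = complex_of_real C"
    using green_form_nonneg[OF continuous_on_string_phi] by blast
  define A where "A = (\<integral>s. (norm (?\<phi> s))\<^sup>2 \<partial>M)"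
  have A0: "0 \<le> A" by (simp add: A_def)
  have green: "?\<phi> s = z\<^sup>2 * (\<integral>r. complex_of_real (l - max s r) * ?\<phi> r \<partial>M) + \<i> * z * P"
    if "s \<in> {0..l}" for s
    using string_phi_eq_green[OF that, of z]
    by (simp add: F green_integral_eq[OF continuous_on_string_phi] P_def)
  have z0: "z \<noteq> 0"
    using green[of 0] l_pos string_phi_0[of z] by auto
  \<comment> \<open>Continuity of the inner integral, needed to integrate once more, is read off
    from the integral equation by solving for it; this uses that z is nonzero.\<close>
  have cG: "continuous_on {0..l} (\<lambda>s. \<integral>r. complex_of_real (l - max s r) * ?\<phi> r \<partial>M)"
  proof -
    have "(\<integral>r. complex_of_real (l - max s r) * ?\<phi> r \<partial>M) = (?\<phi> s - \<i> * z * P) / z\<^sup>2" if "s \<in> {0..l}" for s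
      by (subst green[OF that]) (use z0 in simp)
    moreover have "continuous_on {0..l} (\<lambda>s. (?\<phi> s - \<i> * z * P) / z\<^sup>2)"
      by (intro continuous_intros) (use z0 in auto)
    ultimately show ?thesis by (metis (no_types, lifting) continuous_on_eq)
  qed
  have "complex_of_real A = (\<integral>s. cnj (?\<phi> s) * ?\<phi> s \<partial>M)"
    unfolding A_def by (subst integral_complex_of_real[symmetric]) (simp only: complex_norm_square mult.commute)
  also have "\<dots> = (\<integral>s. z\<^sup>2 * (cnj (?\<phi> s) * (\<integral>r. complex_of_real (l - max s r) * ?\<phi> r \<partial>M))
       + \<i> * z * P * cnj (?\<phi> s) \<partial>M)"
  proof (rule Bochner_Integration.integral_cong[OF refl])
    fix s assume "s \<in> space M"
    then have "cnj (?\<phi> s) * ?\<phi> s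
       = cnj (?\<phi> s) * (z\<^sup>2 * (\<integral>r. complex_of_real (l - max s r) * ?\<phi> r \<partial>M) + \<i> * z * P)"
      using green[of s] by simp
    then show "cnj (?\<phi> s) * ?\<phi> s = z\<^sup>2 * (cnj (?\<phi> s) * (\<integral>r. complex_of_real (l - max s r) * ?\<phi> r \<partial>M))
       + \<i> * z * P * cnj (?\<phi> s)"
      by (simp add: algebra_simps)
  qed
  also have "\<dots> = z\<^sup>2 * (\<integral>s. cnj (?\<phi> s) * (\<integral>r. complex_of_real (l - max s r) * ?\<phi> r \<partial>M) \<partial>M)
       + \<i> * z * P * (\<integral>s. cnj (?\<phi> s) \<partial>M)"
    by (subst Bochner_Integration.integral_add,
        (intro integrable_continuous continuous_intros cG)+) simp
  also have "(\<integral>s. cnj (?\<phi> s) \<partial>M) = cnj P" by (simp add: P_def)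
  finally have "complex_of_real A = z * (z * complex_of_real C + \<i> * (P * cnj P))"
    unfolding C(2) by (simp add: power2_eq_square algebra_simps)
  also have "P * cnj P = complex_of_real ((norm P)\<^sup>2)" by (simp only: complex_norm_square)
  finally have "cnj z * complex_of_real A
      = (cnj z * z) * (z * complex_of_real C + \<i> * complex_of_real ((norm P)\<^sup>2))" by (simp add: mult.assoc)
  also have "cnj z * z = complex_of_real ((norm z)\<^sup>2)" by (simp only: complex_norm_square mult.commute)
  finally have "- Im z * A = (norm z)\<^sup>2 * (Im z * C + (norm P)\<^sup>2)"
    by (auto simp: complex_eq_iff)
  then have "Im z * (A + (norm z)\<^sup>2 * C) = - ((norm z)\<^sup>2 * (norm P)\<^sup>2)"
    by (simp add: algebra_simps)
  moreover have "0 < (norm z)\<^sup>2 * (norm P)\<^sup>2" using z0 P by simp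
  ultimately have "Im z * (A + (norm z)\<^sup>2 * C) < 0" by simp
  moreover have "0 \<le> A + (norm z)\<^sup>2 * C" using A0 C(1) by simp
  ultimately show ?thesis by (smt (verit) mult_nonneg_nonneg)
qed

end

subsection \<open>Transported strings and duality\<close>

text \<open>The integral of \<open>\<phi> * u\<close> is computed twice, once by inserting the
  equation of \<open>u\<close> and once by inserting that of \<phi> and moving \<open>H\<close> over
  by symmetry. The pairing is bilinear, without conjugation. Symmetry is asked of \<open>H\<close>
  alone: in the application \<open>H'\<close> carries a density in its second variable.\<close>

lemma kernel_duality:
  fixes \<phi> u :: "'a \<Rightarrow> complex" and H H' :: "'a \<Rightarrow> 'a \<Rightarrow> complex"
  assumes fin: "finite_measure M"
    and [measurable]: "\<phi> \<in> borel_measurable M" "u \<in> borel_measurable M"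
      "case_prod H \<in> borel_measurable (M \<Otimes>\<^sub>M M)" "case_prod H' \<in> borel_measurable (M \<Otimes>\<^sub>M M)"
    and bounds: "\<And>s. s \<in> space M \<Longrightarrow> norm (\<phi> s) \<le> B" "\<And>s. s \<in> space M \<Longrightarrow> norm (u s) \<le> B"
      "\<And>t s. t \<in> space M \<Longrightarrow> s \<in> space M \<Longrightarrow> norm (H t s) \<le> B"
      "\<And>t s. t \<in> space M \<Longrightarrow> s \<in> space M \<Longrightarrow> norm (H' t s) \<le> B"
    and sym: "\<And>t s. H t s = H s t"
    and \<phi>: "\<And>t. t \<in> space M \<Longrightarrow> \<phi> t = (\<integral>s. H t s * \<phi> s \<partial>M)"
    and u: "\<And>t. t \<in> space M \<Longrightarrow> u t = f + (\<integral>s. H' t s * u s \<partial>M)"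
  shows "f * (\<integral>t. \<phi> t \<partial>M) = (\<integral>(t, s). \<phi> t * ((H t s - H' t s) * u s) \<partial>(M \<Otimes>\<^sub>M M))"
proof (cases "space M = {}")
  case True
  then have "space (M \<Otimes>\<^sub>M M) = {}" by (simp add: space_pair_measure)
  then show ?thesis by (simp add: True Bochner_Integration.integral_empty)
next
  case False
  interpret finite_measure M by fact
  interpret P: pair_sigma_finite M M ..
  \<comment> \<open>The sign of \<open>B\<close> comes from evaluating a bound at a point, which is
    why the empty space is split off.\<close>
  have B: "0 \<le> B" using False bounds(1) norm_ge_zero order_trans by blast
  have bd: "norm (\<phi> t * (G t s * u s)) \<le> B * (B * B)"
    if "t \<in> space M" "s \<in> space M" "norm (G t s) \<le> B" for t s and G :: "'a \<Rightarrow> 'a \<Rightarrow> complex"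
    unfolding norm_mult using that bounds B by (intro mult_mono mult_nonneg_nonneg) auto
  have int: "integrable (M \<Otimes>\<^sub>M M) (\<lambda>(t, s). \<phi> t * (H t s * u s))"
    "integrable (M \<Otimes>\<^sub>M M) (\<lambda>(t, s). \<phi> t * (H' t s * u s))"
    using bd bounds(3,4) by (intro integrable_pair_bounded[where B = "B * (B * B)"] fin; simp)+
  have int\<phi>: "integrable M \<phi>"
    using bounds(1) by (intro integrable_const_bound[where B = B]) auto
  have int2: "integrable M (\<lambda>t. \<integral>s. \<phi> t * (H' t s * u s) \<partial>M)"
    using P.integrable_fst'[OF int(2)] by simp
  have "(\<integral>t. \<phi> t * u t \<partial>M) = (\<integral>t. f * \<phi> t + (\<integral>s. \<phi> t * (H' t s * u s) \<partial>M) \<partial>M)"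
    by (rule Bochner_Integration.integral_cong[OF refl]) (simp add: u distrib_left mult.commute)
  also have "\<dots> = f * (\<integral>t. \<phi> t \<partial>M) + (\<integral>(t, s). \<phi> t * (H' t s * u s) \<partial>(M \<Otimes>\<^sub>M M))"
    using int\<phi> int2 P.integral_fst'[OF int(2)] by simp
  finally have 1: "(\<integral>t. \<phi> t * u t \<partial>M)
      = f * (\<integral>t. \<phi> t \<partial>M) + (\<integral>(t, s). \<phi> t * (H' t s * u s) \<partial>(M \<Otimes>\<^sub>M M))" .
  have "(\<integral>s. \<phi> s * u s \<partial>M) = (\<integral>s. (\<integral>t. \<phi> t * (H t s * u s) \<partial>M) \<partial>M)"
  proof (rule Bochner_Integration.integral_cong[OF refl])
    fix s assume "s \<in> space M"
    then have "\<phi> s * u s = (\<integral>t. H s t * \<phi> t \<partial>M) * u s" using \<phi> by metis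
    also have "\<dots> = (\<integral>t. (H s t * \<phi> t) * u s \<partial>M)" by (rule integral_mult_left_zero[symmetric])
    finally show "\<phi> s * u s = (\<integral>t. \<phi> t * (H t s * u s) \<partial>M)" by (simp add: sym[of s] mult_ac)
  qed
  also have "\<dots> = (\<integral>t. (\<integral>s. \<phi> t * (H t s * u s) \<partial>M) \<partial>M)"
    using int(1) by (rule P.Fubini_integral)
  also have "\<dots> = (\<integral>(t, s). \<phi> t * (H t s * u s) \<partial>(M \<Otimes>\<^sub>M M))"
    using P.integral_fst'[OF int(1)] by simp
  finally have "f * (\<integral>t. \<phi> t \<partial>M) = (\<integral>(t, s). \<phi> t * (H t s * u s) \<partial>(M \<Otimes>\<^sub>M M))
       - (\<integral>(t, s). \<phi> t * (H' t s * u s) \<partial>(M \<Otimes>\<^sub>M M))" using 1 by (simp add: eq_diff_eq)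
  also have "\<dots> = (\<integral>(t, s). \<phi> t * ((H t s - H' t s) * u s) \<partial>(M \<Otimes>\<^sub>M M))"
    by (subst Bochner_Integration.integral_diff[OF int, symmetric])
      (simp add: case_prod_beta' left_diff_distrib right_diff_distrib)
  finally show ?thesis .
qed

lemma norm_green_kernel_le:
  assumes "x \<in> {0..l}" "s \<in> {0..l}"
  shows "norm (green_kernel l z x s) \<le> (norm z)\<^sup>2 * l + norm z"
proof -
  have "norm (green_kernel l z x s) \<le> norm (z\<^sup>2 * complex_of_real (l - max x s)) + norm (\<i> * z)"
    unfolding green_kernel_def by (rule norm_triangle_ineq)
  also have "\<dots> = (norm z)\<^sup>2 * \<bar>l - max x s\<bar> + norm z"
    by (simp only: norm_mult norm_power norm_of_real norm_ii mult_1)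
  also have "\<dots> \<le> (norm z)\<^sup>2 * l + norm z"
    using assms by (intro add_right_mono mult_left_mono) auto
  finally show ?thesis .
qed

lemma measurable_green_kernel [measurable]:
  assumes [measurable]: "f \<in> borel_measurable N" "g \<in> borel_measurable N"
  shows "(\<lambda>p. green_kernel l z (f p) (g p)) \<in> borel_measurable N"
  unfolding green_kernel_def by measurable

text \<open>A competitor is the image under \<open>y\<close> of the string with density
  \<open>w\<close>. Composed with \<open>y\<close>, its solution satisfies equations over the
  original \<open>M\<close> with a modified kernel, as required to pair it with the original
  solution.\<close>

locale transported_string = krein_string l M for l M +
  fixes w y :: "real \<Rightarrow> real" and W :: real
  assumes w_meas [measurable]: "w \<in> borel_measurable M"
    and y_meas [measurable]: "y \<in> measurable M M"
    and w_nonneg: "\<And>s. s \<in> {0..l} \<Longrightarrow> 0 \<le> w s"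
    and w_le: "\<And>s. s \<in> {0..l} \<Longrightarrow> w s \<le> W"
begin

definition image_string :: "real measure" where
  "image_string = distr (density M (\<lambda>s. ennreal (w s))) M y"

lemma sets_image_string [measurable_cong]: "sets image_string = sets M"
  by (simp add: image_string_def)

lemma y_in: "s \<in> {0..l} \<Longrightarrow> y s \<in> {0..l}"
  using measurable_space[OF y_meas] by simp

lemma y_borel [measurable]: "y \<in> borel_measurable M"
  using measurable_compose[OF y_meas measurable_M_ident] by simp

lemma integrable_w: "integrable M w"
  using w_nonneg w_le by (intro integrable_const_bound[where B = W]) auto

lemma integral_image_string:
  fixes f :: "real \<Rightarrow> complex"
  assumes [measurable]: "f \<in> borel_measurable M"
  shows "(\<integral>s. f s \<partial>image_string) = (\<integral>s. complex_of_real (w s) * f (y s) \<partial>M)"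
proof -
  have "(\<integral>s. f s \<partial>image_string) = (\<integral>s. f (y s) \<partial>density M (\<lambda>s. ennreal (w s)))"
    unfolding image_string_def by (rule integral_distr) auto
  also have "\<dots> = (\<integral>s. w s *\<^sub>R f (y s) \<partial>M)"
    by (rule integral_density) (use w_nonneg in auto)
  finally show ?thesis by (simp add: scaleR_conv_of_real)
qed

lemma emeasure_image_string: "emeasure image_string (space image_string) = ennreal (\<integral>s. w s \<partial>M)"
proof -
  have "y -` {0..l} \<inter> {0..l} = {0..l}" using y_in by auto
  then have "emeasure image_string (space image_string) = (\<integral>\<^sup>+s. ennreal (w s) * indicator {0..l} s \<partial>M)"
    using sets.top[of M] by (simp add: image_string_def emeasure_distr emeasure_density)
  also have "\<dots> = (\<integral>\<^sup>+s. ennreal (w s) \<partial>M)" by (rule nn_integral_cong) auto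
  also have "\<dots> = ennreal (\<integral>s. w s \<partial>M)"
    by (rule nn_integral_eq_integral[OF integrable_w]) (use w_nonneg in auto)
  finally show ?thesis .
qed

lemma total_mass_image_string: "total_mass image_string = (\<integral>s. w s \<partial>M)"
proof -
  have "0 \<le> (\<integral>s. w s \<partial>M)"
    using w_nonneg by (intro Bochner_Integration.integral_nonneg_AE AE_I2) auto
  then show ?thesis unfolding total_mass_def measure_def emeasure_image_string by simp
qed

lemma is_string_image: "is_string l image_string"
  unfolding is_string_def
proof
  show "sets image_string = sets (restrict_space borel {0..l})"
    using sets_image_string sets_M by simp
  show "finite_measure image_string"
    by standard (simp add: emeasure_image_string)
qed

sublocale im: krein_string l image_string
  by standard (use l_pos is_string_image in auto)

definition transported_phi :: "complex \<Rightarrow> real \<Rightarrow> complex" where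
  "transported_phi z s = string_phi l image_string z (y s)"

lemma measurable_string_phi_image [measurable]: "string_phi l image_string z \<in> borel_measurable M"
  using im.measurable_string_phi measurable_cong_sets[OF sets_image_string refl] by blast

lemma measurable_transported_phi [measurable]: "transported_phi z \<in> borel_measurable M"
  unfolding transported_phi_def by measurable

lemma transported_phi_bounded:
  obtains B where "0 < B" "\<And>s. s \<in> {0..l} \<Longrightarrow> norm (transported_phi z s) \<le> B"
  using im.bounded_continuous[OF im.continuous_on_string_phi] y_in unfolding transported_phi_def by metis

lemma transported_phi_volterra:
  assumes "t \<in> {0..l}"
  shows "transported_phi z t = 1 - (\<integral>s. z\<^sup>2 * complex_of_real (max 0 (y t - y s) * w s) * transported_phi z s \<partial>M)"
proof -
  have "(\<integral>s. complex_of_real (max 0 (y t - s)) * string_phi l image_string z s \<partial>image_string)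
     = (\<integral>s. complex_of_real (w s) * (complex_of_real (max 0 (y t - y s)) * transported_phi z s) \<partial>M)"
    unfolding transported_phi_def by (rule integral_image_string) measurable
  then show ?thesis
    using im.string_phi_eq[OF y_in[OF assms], of z]
    by (simp add: transported_phi_def mult_ac flip: integral_mult_right_zero)
qed

lemma transported_phi_green:
  assumes "t \<in> {0..l}"
  shows "transported_phi z t = string_F l image_string z
    + (\<integral>s. green_kernel l z (y t) (y s) * complex_of_real (w s) * transported_phi z s \<partial>M)"
proof -
  have "(\<integral>s. green_kernel l z (y t) s * string_phi l image_string z s \<partial>image_string)
     = (\<integral>s. complex_of_real (w s) * (green_kernel l z (y t) (y s) * transported_phi z s) \<partial>M)"
    unfolding transported_phi_def by (rule integral_image_string) measurable
  then show ?thesis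
    using im.string_phi_eq_green[OF y_in[OF assms], of z]
    by (simp add: transported_phi_def mult_ac)
qed

text \<open>The solution equals 1 at the point 0, so the Green equation there becomes an explicit
  formula for \<open>F\<close>. Continuity in the parameters is later deduced from it.\<close>

lemma string_F_image:
  "string_F l image_string z
    = 1 - (\<integral>s. green_kernel l z 0 (y s) * complex_of_real (w s) * transported_phi z s \<partial>M)"
proof -
  have "(\<integral>s. green_kernel l z 0 s * string_phi l image_string z s \<partial>image_string)
     = (\<integral>s. complex_of_real (w s) * (green_kernel l z 0 (y s) * transported_phi z s) \<partial>M)"
    unfolding transported_phi_def by (rule integral_image_string) measurable
  then show ?thesis
    using im.string_phi_eq_green[of 0 z] im.string_phi_0[of z] l_pos by (simp add: mult_ac eq_diff_eq)
qed

text \<open>At a quasi-eigenvalue the momentum on the left is nonzero, so this determines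
  \<open>F\<close> of the competitor at an arbitrary z'. It is used with an integrand that vanishes
  almost everywhere (stretching) and with one that is expanded to first order (bump
  perturbation).\<close>

lemma string_F_duality:
  assumes F: "string_F l M z = 0"
  shows "string_F l image_string z' * (\<integral>s. string_phi l M z s \<partial>M)
    = (\<integral>(t, s). string_phi l M z t * ((green_kernel l z t s - green_kernel l z' (y t) (y s) * complex_of_real (w s))
        * transported_phi z' s) \<partial>(M \<Otimes>\<^sub>M M))"
proof -
  obtain B1 where B1: "0 < B1" "\<And>x. x \<in> {0..l} \<Longrightarrow> norm (string_phi l M z x) \<le> B1"
    using bounded_continuous[OF continuous_on_string_phi] by blast
  obtain B2 where B2: "0 < B2" "\<And>x. x \<in> {0..l} \<Longrightarrow> norm (transported_phi z' x) \<le> B2"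
    using transported_phi_bounded by blast
  define B where "B = Max {B1, B2, (norm z)\<^sup>2 * l + norm z, ((norm z')\<^sup>2 * l + norm z') * W}"
  have B: "B1 \<le> B" "B2 \<le> B" "(norm z)\<^sup>2 * l + norm z \<le> B" "((norm z')\<^sup>2 * l + norm z') * W \<le> B"
    unfolding B_def by (rule Max_ge; simp)+
  show ?thesis
  proof (rule kernel_duality[OF finite_measure_axioms])
    show "norm (green_kernel l z t s) \<le> B" if "t \<in> space M" "s \<in> space M" for t s
      using norm_green_kernel_le[of t l s z] that B(3) by simp
    show "norm (green_kernel l z' (y t) (y s) * complex_of_real (w s)) \<le> B" if "t \<in> space M" "s \<in> space M" for t s
    proof -
      have "norm (green_kernel l z' (y t) (y s) * complex_of_real (w s)) \<le> ((norm z')\<^sup>2 * l + norm z') * W"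
        unfolding norm_mult norm_of_real
        using that w_nonneg w_le y_in l_pos norm_green_kernel_le[of "y t" l "y s" z']
        by (intro mult_mono) auto
      then show ?thesis using B(4) by linarith
    qed
    show "norm (string_phi l M z s) \<le> B" if "s \<in> space M" for s
      using B1(2)[of s] B(1) that by simp
    show "norm (transported_phi z' s) \<le> B" if "s \<in> space M" for s
      using B2(2)[of s] B(2) that by simp
    show "string_phi l M z t = (\<integral>s. green_kernel l z t s * string_phi l M z s \<partial>M)" if "t \<in> space M" for t
      using string_phi_eq_green[of t z] that by (simp add: F)
    show "transported_phi z' t = string_F l image_string z' +
        (\<integral>s. green_kernel l z' (y t) (y s) * complex_of_real (w s) * transported_phi z' s \<partial>M)"
      if "t \<in> space M" for t
      using transported_phi_green[of t z'] that by simp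
    show "green_kernel l z t s = green_kernel l z s t" for t s by (rule green_kernel_commute)
  qed measurable
qed


end

subsection \<open>Stability of Volterra equations\<close>

context krein_string begin

text \<open>Gronwall's inequality for a complex kernel dominated by the string kernel, with a final
  constant independent of \<open>t\<close>. The number \<open>e\<close> stands for the constant 1 in
  an a priori bound and for the size of the perturbation in a stability bound.\<close>

lemma volterra_estimate:
  fixes d :: "real \<Rightarrow> complex" and K :: "real \<Rightarrow> real \<Rightarrow> complex"
  assumes [measurable]: "d \<in> borel_measurable M"
    and bdd: "\<And>t. t \<in> {0..l} \<Longrightarrow> norm (d t) \<le> B"
    and K: "\<And>t s. t \<in> {0..l} \<Longrightarrow> s \<in> {0..l} \<Longrightarrow> norm (K t s) \<le> c * max 0 (t - s)"
    and c: "0 \<le> c" and e: "0 \<le> e"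
    and ineq: "\<And>t. t \<in> {0..l} \<Longrightarrow> norm (d t) \<le> e + norm (\<integral>s. K t s * d s \<partial>M)"
    and t: "t \<in> {0..l}"
  shows "norm (d t) \<le> 2 * e * exp ((2 * c * measure M {0..l} + 1) * l)"
proof -
  have B: "0 \<le> B" using bdd[OF t] norm_ge_zero order_trans by blast
  have "norm (d t) \<le> 2 * e * exp ((2 * c * measure M (space M) + 1) * t)"
  proof (rule gronwall_volterra[where B = B and \<rho> = "\<lambda>x. x" and v = "\<lambda>x. norm (d x)"])
    fix x assume "x \<in> space M"
    then have x: "x \<in> {0..l}" by simp
    have "norm (\<integral>s. K x s * d s \<partial>M) \<le> (\<integral>s. norm (K x s * d s) \<partial>M)"
      by (rule integral_norm_bound)
    also have "\<dots> \<le> (\<integral>s. c * (max 0 (x - s) * norm (d s)) \<partial>M)"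
    proof (rule integral_mono')
      have "norm (c * (max 0 (x - s) * norm (d s))) \<le> c * (l * B)" if "s \<in> {0..l}" for s
      proof -
        have "max 0 (x - s) * norm (d s) \<le> l * B"
          using that x bdd[OF that] l_pos by (intro mult_mono) auto
        then show ?thesis using c by (simp add: abs_mult mult_left_mono)
      qed
      then show "integrable M (\<lambda>s. c * (max 0 (x - s) * norm (d s)))"
        by (intro integrable_const_bound[where B = "c * (l * B)"] AE_I2) auto
      fix s assume "s \<in> space M"
      then show "norm (K x s * d s) \<le> c * (max 0 (x - s) * norm (d s))"
        using mult_right_mono[OF K[OF x, of s] norm_ge_zero[of "d s"]] by (simp add: norm_mult mult.assoc)
    qed (use c in auto)
    finally show "norm (d x) \<le> e + c * (\<integral>s. max 0 (x - s) * norm (d s) \<partial>M)"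
      using ineq[OF x] by simp
  qed (use t c e bdd finite_measure_axioms in auto)
  also have "\<dots> \<le> 2 * e * exp ((2 * c * measure M {0..l} + 1) * l)"
    using t c e by (auto intro!: mult_left_mono)
  finally show ?thesis .
qed

lemma volterra_bound:
  fixes u :: "real \<Rightarrow> complex" and K :: "real \<Rightarrow> real \<Rightarrow> complex"
  assumes "u \<in> borel_measurable M"
    and "\<And>t. t \<in> {0..l} \<Longrightarrow> norm (u t) \<le> B"
    and "\<And>t s. t \<in> {0..l} \<Longrightarrow> s \<in> {0..l} \<Longrightarrow> norm (K t s) \<le> c * max 0 (t - s)"
    and "0 \<le> c"
    and u: "\<And>t. t \<in> {0..l} \<Longrightarrow> u t = 1 - (\<integral>s. K t s * u s \<partial>M)"
    and "t \<in> {0..l}"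
  shows "norm (u t) \<le> 2 * exp ((2 * c * measure M {0..l} + 1) * l)"
proof -
  have "norm (u t) \<le> 1 + norm (\<integral>s. K t s * u s \<partial>M)" if "t \<in> {0..l}" for t
    using u[OF that] norm_triangle_ineq4[of 1 "\<integral>s. K t s * u s \<partial>M"] by simp
  then show ?thesis
    using volterra_estimate[where e = 1 and d = u, OF assms(1-4)] assms(6) by simp
qed

text \<open>The difference \<open>u - u'\<close> solves the equation with kernel \<open>K\<close>
  and source \<open>- \<integral>(K - K') * u'\<close>. One factor \<open>E c\<close> bounds
  \<open>u'\<close>, the other comes from Gronwall. Since \<open>B\<close> and \<open>B'\<close> do
  not enter, the constant is uniform over families of strings.\<close>

lemma volterra_stability:
  fixes u u' :: "real \<Rightarrow> complex" and K K' :: "real \<Rightarrow> real \<Rightarrow> complex"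
  defines "E \<equiv> \<lambda>c. 2 * exp ((2 * c * measure M {0..l} + 1) * l)"
  assumes [measurable]: "u \<in> borel_measurable M" "u' \<in> borel_measurable M"
      "\<And>t. t \<in> {0..l} \<Longrightarrow> K t \<in> borel_measurable M" "\<And>t. t \<in> {0..l} \<Longrightarrow> K' t \<in> borel_measurable M"
    and bdd: "\<And>t. t \<in> {0..l} \<Longrightarrow> norm (u t) \<le> B" "\<And>t. t \<in> {0..l} \<Longrightarrow> norm (u' t) \<le> B'"
    and K: "\<And>t s. t \<in> {0..l} \<Longrightarrow> s \<in> {0..l} \<Longrightarrow> norm (K t s) \<le> c * max 0 (t - s)"
    and K': "\<And>t s. t \<in> {0..l} \<Longrightarrow> s \<in> {0..l} \<Longrightarrow> norm (K' t s) \<le> c * max 0 (t - s)"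
    and KK': "\<And>t s. t \<in> {0..l} \<Longrightarrow> s \<in> {0..l} \<Longrightarrow> norm (K t s - K' t s) \<le> \<epsilon>"
    and c: "0 \<le> c" and \<epsilon>: "0 \<le> \<epsilon>"
    and u: "\<And>t. t \<in> {0..l} \<Longrightarrow> u t = 1 - (\<integral>s. K t s * u s \<partial>M)"
    and u': "\<And>t. t \<in> {0..l} \<Longrightarrow> u' t = 1 - (\<integral>s. K' t s * u' s \<partial>M)"
    and t: "t \<in> {0..l}"
  shows "norm (u t - u' t) \<le> measure M {0..l} * (E c)\<^sup>2 * \<epsilon>"
proof -
  have E: "0 \<le> E c" by (simp add: E_def)
  have u'_le: "norm (u' s) \<le> E c" if "s \<in> {0..l}" for s
    unfolding E_def by (rule volterra_bound[where K = K' and B = B']) (use that bdd K' c u' in auto)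
  have le_cl: "c * max 0 (t - s) \<le> c * l" if "t \<in> {0..l}" "s \<in> {0..l}" for t s
    using that c by (intro mult_left_mono) auto
  have int: "integrable M (\<lambda>s. k t s * v s)"
    if "t \<in> {0..l}" "\<And>t s. t \<in> {0..l} \<Longrightarrow> s \<in> {0..l} \<Longrightarrow> norm (k t s) \<le> c * max 0 (t - s)"
      "\<And>s. s \<in> {0..l} \<Longrightarrow> norm (v s) \<le> b" and [measurable]: "k t \<in> borel_measurable M" "v \<in> borel_measurable M"
    for k :: "real \<Rightarrow> real \<Rightarrow> complex" and v t b
  proof -
    have "norm (k t s * v s) \<le> (c * l) * b" if "s \<in> {0..l}" for s
      unfolding norm_mult using that \<open>t \<in> {0..l}\<close> le_cl c l_pos
        order_trans[OF \<open>\<And>t s. t \<in> {0..l} \<Longrightarrow> s \<in> {0..l} \<Longrightarrow> norm (k t s) \<le> c * max 0 (t - s)\<close> le_cl]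
        \<open>\<And>s. s \<in> {0..l} \<Longrightarrow> norm (v s) \<le> b\<close>
      by (intro mult_mono) auto
    then show ?thesis by (intro integrable_const_bound[where B = "(c * l) * b"] AE_I2) auto
  qed
  have "norm (u t - u' t) \<le> 2 * (measure M {0..l} * (\<epsilon> * E c)) * exp ((2 * c * measure M {0..l} + 1) * l)"
  proof (rule volterra_estimate[where B = "B + B'" and K = K])
    fix t assume t: "t \<in> {0..l}"
    have [measurable]: "K t \<in> borel_measurable M" "K' t \<in> borel_measurable M" using t by auto
    have "norm (u t) + norm (u' t) \<le> B + B'" using bdd[OF t] by (rule add_mono)
    then show "norm (u t - u' t) \<le> B + B'" using norm_triangle_ineq4 order_trans by blast
    have i1: "integrable M (\<lambda>s. K t s * u s)"
      by (rule int[where k = K and b = B]) (use t K bdd in auto)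
    have i2: "integrable M (\<lambda>s. K t s * u' s)"
      by (rule int[where k = K and b = B']) (use t K bdd in auto)
    have i3: "integrable M (\<lambda>s. K' t s * u' s)"
      by (rule int[where k = K' and b = B']) (use t K' bdd in auto)
    have 1: "(\<integral>s. K t s * (u s - u' s) \<partial>M) = (\<integral>s. K t s * u s \<partial>M) - (\<integral>s. K t s * u' s \<partial>M)"
      unfolding right_diff_distrib
      by (rule Bochner_Integration.integral_diff[OF i1 i2])
    have 2: "(\<integral>s. (K t s - K' t s) * u' s \<partial>M) = (\<integral>s. K t s * u' s \<partial>M) - (\<integral>s. K' t s * u' s \<partial>M)"
      unfolding left_diff_distrib
      by (rule Bochner_Integration.integral_diff[OF i2 i3])
    have "u t - u' t = - ((\<integral>s. (K t s - K' t s) * u' s \<partial>M) + (\<integral>s. K t s * (u s - u' s) \<partial>M))"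
      unfolding 1 2 using u[OF t] u'[OF t] by simp
    then have "norm (u t - u' t) \<le> norm (\<integral>s. (K t s - K' t s) * u' s \<partial>M) + norm (\<integral>s. K t s * (u s - u' s) \<partial>M)"
      by (simp only: norm_minus_cancel norm_triangle_ineq)
    also have "norm (\<integral>s. (K t s - K' t s) * u' s \<partial>M) \<le> measure M {0..l} * (\<epsilon> * E c)"
    proof (rule norm_integral_le)
      fix s assume s: "s \<in> {0..l}"
      show "norm ((K t s - K' t s) * u' s) \<le> \<epsilon> * E c"
        unfolding norm_mult by (rule mult_mono[OF KK'[OF t s] u'_le[OF s] \<epsilon> norm_ge_zero])
    qed (rule mult_nonneg_nonneg[OF \<epsilon> E])
    finally show "norm (u t - u' t) \<le> measure M {0..l} * (\<epsilon> * E c) + norm (\<integral>s. K t s * (u s - u' s) \<partial>M)"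
      by simp
  qed (use t in \<open>simp_all add: K c \<epsilon> E\<close>)
  also have "\<dots> = measure M {0..l} * (E c)\<^sup>2 * \<epsilon>"
    by (simp add: E_def power2_eq_square)
  finally show ?thesis .
qed

subsection \<open>Support and stretching\<close>

text \<open>The support lies in \<open>{0..l}\<close>, so if it contained 0 this would be its least
  element. Otherwise 0 has a null neighbourhood, and from here on the support is handled only
  through almost-everywhere statements.\<close>

lemma AE_away_from_0:
  assumes "a_star l M \<noteq> 0" "total_mass M \<noteq> 0"
  obtains r where "0 < r" "AE s in M. r \<le> s"
proof -
  have "0 \<notin> string_supp M"
  proof
    assume "0 \<in> string_supp M"
    then have "(LEAST x. x \<in> string_supp M) = 0"
      by (rule Least_equality) (auto simp: string_supp_def)
    then show False using assms by (simp add: a_star_def)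
  qed
  then obtain U where U: "open U" "0 \<in> U" "emeasure M (U \<inter> {0..l}) = 0"
    using l_pos by (auto simp: string_supp_def not_gr_zero)
  then obtain r where r: "0 < r" "ball 0 r \<subseteq> U" using openE by blast
  have "U \<inter> {0..l} \<in> sets M"
    using U(1) by (auto simp: sets_M sets_restrict_space)
  then have "AE s in M. s \<notin> U \<inter> {0..l}"
    using U(3) by (intro AE_not_in) (auto simp: null_sets_def)
  then have "AE s in M. r \<le> s"
    by (rule AE_mp[OF _ AE_I2]) (use r(2) in \<open>force simp: subset_iff dist_real_def\<close>)
  then show ?thesis using r(1) that by blast
qed

text \<open>\<open>a\<close> is the essential infimum of the position. It is attained because
  countably many almost-everywhere inequalities can be combined, and the mass being nonzero keeps it
  at most \<open>l\<close>.\<close>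

lemma left_end_of_support:
  assumes "total_mass M \<noteq> 0" "0 < r" "AE s in M. r \<le> s"
  obtains a where "0 < a" "a \<le> l" "AE s in M. a \<le> s" "\<And>b. a < b \<Longrightarrow> \<not> (AE s in M. b \<le> s)"
proof -
  define S where "S = {x. AE s in M. x \<le> s}"
  have le: "x \<le> l" if "x \<in> S" for x
  proof (rule ccontr)
    assume "\<not> x \<le> l"
    have "AE s in M. x \<le> s" using that by (simp add: S_def)
    then have "AE s in M. False"
      by (rule AE_mp[OF _ AE_I2]) (use \<open>\<not> x \<le> l\<close> in auto)
    then have "emeasure M (space M) = 0" using emeasure_eq_0_AE[of "\<lambda>_. True" M] by (simp del: space_M)
    then show False using assms(1) by (simp add: total_mass_def measure_def)
  qed
  have bdd: "bdd_above S" using le by (auto simp: bdd_above_def)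
  have rS: "r \<in> S" using assms(3) by (simp add: S_def)
  define a where "a = Sup S"
  have ra: "r \<le> a" unfolding a_def by (rule cSup_upper[OF rS bdd])
  have "AE s in M. a - 1 / real (Suc n) \<le> s" for n
  proof -
    have "a - 1 / real (Suc n) < Sup S" by (simp add: a_def)
    then obtain x where x: "x \<in> S" "a - 1 / real (Suc n) < x"
      using less_cSup_iff[OF _ bdd] rS by blast
    then have "AE s in M. x \<le> s" by (simp add: S_def)
    then show ?thesis by (rule AE_mp[OF _ AE_I2]) (use x(2) in auto)
  qed
  then have "AE s in M. \<forall>n. a - 1 / real (Suc n) \<le> s" by (simp add: AE_all_countable)
  then have "AE s in M. a \<le> s"
  proof (rule AE_mp[OF _ AE_I2], intro impI)
    fix s assume *: "\<forall>n. a - 1 / real (Suc n) \<le> s"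
    have "(\<lambda>n. a - 1 / real (Suc n)) \<longlonglongrightarrow> a - 0"
      by (intro tendsto_intros LIMSEQ_Suc lim_1_over_n)
    then show "a \<le> s" using * by (intro LIMSEQ_le_const2[of _ a]) auto
  qed
  moreover have "\<not> (AE s in M. b \<le> s)" if "a < b" for b
  proof
    assume "AE s in M. b \<le> s"
    then have "b \<le> a" unfolding a_def by (intro cSup_upper[OF _ bdd]) (simp add: S_def)
    then show False using that by simp
  qed
  moreover have "a \<le> l" unfolding a_def using le rS by (intro cSup_least) auto
  ultimately show ?thesis using ra assms(2) that[of a] by auto
qed

text \<open>A point mass \<mu> at \<open>l\<close> turns \<open>F = 0\<close> into
  \<open>\<i> * z * \<mu> = 1\<close>, so z is purely imaginary. For nonzero frequency the support
  therefore begins strictly before \<open>l\<close>, which leaves room for a bump.\<close>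

lemma Re_zero_if_mass_at_end:
  assumes F: "string_F l M z = 0" and AE: "AE s in M. l \<le> s"
  shows "Re z = 0"
proof -
  let ?\<phi> = "string_phi l M z"
  have AEl: "AE s in M. s = l"
    using AE by (rule AE_mp[OF _ AE_I2]) auto
  have "(\<integral>s. ?\<phi> s \<partial>M) = (\<integral>s. ?\<phi> l \<partial>M)"
    by (rule integral_cong_AE) (use AEl in auto)
  then have P: "(\<integral>s. ?\<phi> s \<partial>M) = complex_of_real (measure M {0..l}) * ?\<phi> l"
    by (simp add: scaleR_conv_of_real)
  then have "?\<phi> l \<noteq> 0" using integral_string_phi_nonzero[OF F] by auto
  moreover have "?\<phi> l = \<i> * z * complex_of_real (measure M {0..l}) * ?\<phi> l"
    using F P by (simp add: string_F_eq mult.assoc)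
  ultimately have 1: "\<i> * (z * complex_of_real (measure M {0..l})) = 1"
    by (simp add: mult.assoc)
  then have "measure M {0..l} \<noteq> 0" by auto
  moreover have "Re z * measure M {0..l} = 0" using arg_cong[OF 1, of Im] by simp
  ultimately show ?thesis by simp
qed

text \<open>If a string has no mass near \<open>0\<close>, it can be stretched by a factor \<open>c\<close> away from \<open>l\<close>, with
  its mass multiplied by \<open>c\<close>; this divides the quasi-eigenvalues by \<open>c\<close>.\<close>

lemma stretched_string:
  assumes F: "string_F l M z = 0" and r: "AE s in M. r \<le> s" and c: "0 < c" "c * (l - r) \<le> l"
  obtains M' where "is_string l M'" "total_mass M' = c * total_mass M"
    "string_F l M' (z / complex_of_real c) = 0"
proof -
  \<comment> \<open>Truncation at 0 keeps \<open>y\<close> inside the interval everywhere; it is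
    inactive for \<open>r \<le> s\<close>, hence almost everywhere.\<close>
  define y where "y s = max 0 (l - c * (l - s))" for s
  have y: "y s \<in> {0..l}" if "s \<in> {0..l}" for s
    using that c(1) l_pos by (auto simp: y_def)
  have y_meas: "y \<in> measurable M M"
  proof -
    have "y \<in> measurable M (restrict_space borel {0..l})"
      by (rule measurable_restrict_space2) (use y in \<open>auto simp: y_def[abs_def]\<close>)
    then show ?thesis using measurable_cong_sets[OF refl sets_M] by blast
  qed
  interpret T: transported_string l M "\<lambda>s. c" y c
    by standard (use y_meas c in auto)
  interpret P: pair_sigma_finite M M ..
  have "AE p in M \<Otimes>\<^sub>M M. r \<le> fst p \<and> r \<le> snd p"
  proof (rule AE_conjI)
    show "AE p in M \<Otimes>\<^sub>M M. r \<le> fst p"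
      by (rule P.AE_pair_measure) (use r in \<open>auto intro: AE_mp[OF _ AE_I2]\<close>)
    show "AE p in M \<Otimes>\<^sub>M M. r \<le> snd p"
      by (rule P.AE_pair_measure) (use r in auto)
  qed
  \<comment> \<open>Distances to \<open>l\<close> gain a factor c and so does the density, while z
    loses one. Both the quadratic and the linear term of the kernel are unchanged, so the integrand
    in the duality identity vanishes almost everywhere.\<close>
  moreover have "green_kernel l z t s = green_kernel l (z / complex_of_real c) (y t) (y s) * complex_of_real c"
    if "r \<le> t" "r \<le> s" for t s
  proof -
    have "c * (l - x) \<le> l" if "r \<le> x" for x
    proof -
      have "c * (l - x) \<le> c * (l - r)" using that c(1) by (intro mult_left_mono) auto
      then show ?thesis using c(2) by linarith
    qed
    then have *: "l - max (y t) (y s) = c * (l - max t s)"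
      using that c(1) by (auto simp: y_def max_def)
    show ?thesis
      unfolding green_kernel_def * of_real_mult using c(1) by (simp add: power2_eq_square field_simps)
  qed
  ultimately have "(\<integral>(t, s). string_phi l M z t * ((green_kernel l z t s - green_kernel l (z / complex_of_real c) (y t) (y s) * complex_of_real c)
        * T.transported_phi (z / complex_of_real c) s) \<partial>(M \<Otimes>\<^sub>M M)) = 0"
    by (intro integral_eq_zero_AE) (auto elim: AE_mp[OF _ AE_I2])
  then have "string_F l T.image_string (z / complex_of_real c) = 0"
    using T.string_F_duality[OF F, of "z / complex_of_real c"] integral_string_phi_nonzero[OF F] by simp
  moreover have "total_mass T.image_string = c * total_mass M"
    unfolding T.total_mass_image_string by (simp add: total_mass_def)
  ultimately show ?thesis using that[of T.image_string] T.is_string_image by blast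
qed

end

subsection \<open>Perturbation near the left end of the support\<close>

text \<open>The two-parameter family of competitors: the mass density is multiplied by \<open>1 + \<kappa> * bump\<close> and the
  masses are moved by the monotone map \<open>y \<delta>\<close>. Since \<open>max (y \<delta> t) (y \<delta> s) = y \<delta> (max t s)\<close>, the
  Green kernel depends on \<open>\<delta>\<close> affinely, although \<open>\<phi>\<close> itself has kinks.\<close>

locale bumped_string = krein_string l M for l M +
  fixes b :: real
  assumes b_pos: "0 < b" and b_le: "b \<le> l"
begin

text \<open>A tent over \<open>{0..b}\<close>, positive strictly inside and zero elsewhere.
  Vanishing at 0 and at \<open>l\<close>, it lets \<open>y \<delta>\<close> fix both ends of the
  interval; being 1-Lipschitz, it keeps \<open>y \<delta>\<close> increasing for
  \<open>\<bar>\<delta>\<bar> \<le> 1/2\<close>.\<close>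

definition bump :: "real \<Rightarrow> real" where "bump s = max 0 (min s (b - s))"
definition w :: "real \<Rightarrow> real \<Rightarrow> real" where "w \<kappa> s = 1 + \<kappa> * bump s"
definition y :: "real \<Rightarrow> real \<Rightarrow> real" where "y \<delta> s = s + \<delta> * bump s"
definition small :: "real \<Rightarrow> real \<Rightarrow> bool" where "small \<kappa> \<delta> \<longleftrightarrow> \<bar>\<kappa>\<bar> * l \<le> 1/2 \<and> \<bar>\<delta>\<bar> \<le> 1/2"
text \<open>The image string is spelled out here rather than taken from the locale of transported
  strings, whose assumptions are available for \<open>small\<close> parameters, so that the family
  is a total function of \<kappa> and \<delta>.\<close>

definition pert :: "real \<Rightarrow> real \<Rightarrow> real measure" where
  "pert \<kappa> \<delta> = distr (density M (\<lambda>s. ennreal (w \<kappa> s))) M (y \<delta>)"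
definition pert_phi :: "real \<Rightarrow> real \<Rightarrow> complex \<Rightarrow> real \<Rightarrow> complex" where
  "pert_phi \<kappa> \<delta> z s = string_phi l (pert \<kappa> \<delta>) z (y \<delta> s)"

lemma bump_nonneg: "0 \<le> bump s" by (simp add: bump_def)

lemma bump_le: "s \<in> {0..l} \<Longrightarrow> bump s \<le> l" using b_le by (auto simp: bump_def)

lemma bump_lipschitz: "\<bar>bump s - bump t\<bar> \<le> \<bar>s - t\<bar>" unfolding bump_def by linarith

lemma measurable_bump [measurable]:
  assumes [measurable]: "f \<in> borel_measurable N"
  shows "(\<lambda>x. bump (f x)) \<in> borel_measurable N"
  unfolding bump_def by measurable

lemma measurable_w [measurable]:
  assumes [measurable]: "f \<in> borel_measurable N"
  shows "(\<lambda>x. w \<kappa> (f x)) \<in> borel_measurable N"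
  unfolding w_def by measurable

lemma measurable_y [measurable]:
  assumes [measurable]: "f \<in> borel_measurable N"
  shows "(\<lambda>x. y \<delta> (f x)) \<in> borel_measurable N"
  unfolding y_def by measurable

lemma delta_bump_le: "\<bar>\<delta>\<bar> \<le> 1/2 \<Longrightarrow> \<bar>\<delta> * (bump t - bump s)\<bar> \<le> \<bar>t - s\<bar> / 2"
  using mult_mono[of "\<bar>\<delta>\<bar>" "1/2" "\<bar>bump t - bump s\<bar>" "\<bar>t - s\<bar>"] bump_lipschitz[of t s]
  by (simp add: abs_mult)

lemma y_diff:
  assumes "\<bar>\<delta>\<bar> \<le> 1/2" "t \<le> s"
  shows "0 \<le> y \<delta> s - y \<delta> t" "y \<delta> s - y \<delta> t \<le> 2 * (s - t)"
proof -
  have 1: "y \<delta> s - y \<delta> t = (s - t) + \<delta> * (bump s - bump t)" by (simp add: y_def algebra_simps)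
  have 2: "\<bar>\<delta> * (bump s - bump t)\<bar> \<le> (s - t) / 2" using delta_bump_le[OF assms(1), of s t] assms(2) by simp
  show "0 \<le> y \<delta> s - y \<delta> t" using 1 abs_le_D2[OF 2] assms(2) by simp
  show "y \<delta> s - y \<delta> t \<le> 2 * (s - t)" using 1 abs_le_D1[OF 2] assms(2) by simp
qed

lemma y_mono: "\<bar>\<delta>\<bar> \<le> 1/2 \<Longrightarrow> t \<le> s \<Longrightarrow> y \<delta> t \<le> y \<delta> s"
  using y_diff(1)[of \<delta> t s] by simp

lemma max_y: "\<bar>\<delta>\<bar> \<le> 1/2 \<Longrightarrow> max (y \<delta> t) (y \<delta> s) = y \<delta> (max t s)"
  using y_mono[of \<delta> t s] y_mono[of \<delta> s t] by (cases "t \<le> s") (auto simp: max_def)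

lemma y_in_interval:
  assumes "\<bar>\<delta>\<bar> \<le> 1/2" "s \<in> {0..l}" shows "y \<delta> s \<in> {0..l}"
proof -
  have "y \<delta> 0 = 0" "y \<delta> l = l" using b_pos b_le by (auto simp: y_def bump_def)
  then show ?thesis using y_mono[OF assms(1), of 0 s] y_mono[OF assms(1), of s l] assms(2) by auto
qed

lemma w_bounds:
  assumes "\<bar>\<kappa>\<bar> * l \<le> 1/2" "s \<in> {0..l}" shows "0 \<le> w \<kappa> s" "w \<kappa> s \<le> 2"
proof -
  have "\<bar>\<kappa>\<bar> * bump s \<le> \<bar>\<kappa>\<bar> * l" using bump_le[OF assms(2)] by (intro mult_left_mono) auto
  then have "\<bar>\<kappa> * bump s\<bar> \<le> 1/2" using assms(1) bump_nonneg[of s] by (simp add: abs_mult)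
  then show "0 \<le> w \<kappa> s" "w \<kappa> s \<le> 2" unfolding w_def by linarith+
qed

lemma transported:
  assumes "small \<kappa> \<delta>" shows "transported_string l M (w \<kappa>) (y \<delta>) 2"
proof
  have "y \<delta> \<in> measurable M (restrict_space borel {0..l})"
    by (rule measurable_restrict_space2) (use y_in_interval assms in \<open>auto simp: small_def\<close>)
  then show "y \<delta> \<in> measurable M M" using measurable_cong_sets[OF refl sets_M] by blast
qed (use w_bounds assms in \<open>auto simp: small_def\<close>)

lemma pert_00: "pert 0 0 = M"
  unfolding pert_def w_def y_def by (simp add: density_1 distr_id)

definition pert_kernel :: "real \<Rightarrow> real \<Rightarrow> complex \<Rightarrow> real \<Rightarrow> real \<Rightarrow> complex" where
  "pert_kernel \<kappa> \<delta> z t s = z\<^sup>2 * complex_of_real (max 0 (y \<delta> t - y \<delta> s) * w \<kappa> s)"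

lemma pert_phi_facts:
  assumes "small \<kappa> \<delta>"
  shows "pert_phi \<kappa> \<delta> z \<in> borel_measurable M"
    and "\<exists>B. \<forall>s\<in>{0..l}. norm (pert_phi \<kappa> \<delta> z s) \<le> B"
    and "\<And>t. t \<in> {0..l} \<Longrightarrow> pert_phi \<kappa> \<delta> z t = 1 - (\<integral>s. pert_kernel \<kappa> \<delta> z t s * pert_phi \<kappa> \<delta> z s \<partial>M)"
    and "string_F l (pert \<kappa> \<delta>) z
      = 1 - (\<integral>s. green_kernel l z 0 (y \<delta> s) * complex_of_real (w \<kappa> s) * pert_phi \<kappa> \<delta> z s \<partial>M)"
    and "is_string l (pert \<kappa> \<delta>)"
    and "total_mass (pert \<kappa> \<delta>) = (\<integral>s. w \<kappa> s \<partial>M)"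
proof -
  interpret T: transported_string l M "w \<kappa>" "y \<delta>" 2 by (rule transported[OF assms])
  have [simp]: "T.image_string = pert \<kappa> \<delta>" by (simp add: T.image_string_def pert_def)
  have [simp]: "T.transported_phi z = pert_phi \<kappa> \<delta> z"
    by (simp add: fun_eq_iff T.transported_phi_def pert_phi_def)
  show "pert_phi \<kappa> \<delta> z \<in> borel_measurable M" using T.measurable_transported_phi[of z] by simp
  show "\<exists>B. \<forall>s\<in>{0..l}. norm (pert_phi \<kappa> \<delta> z s) \<le> B"
    using T.transported_phi_bounded[of z] by (metis \<open>T.transported_phi z = pert_phi \<kappa> \<delta> z\<close>)
  show "pert_phi \<kappa> \<delta> z t = 1 - (\<integral>s. pert_kernel \<kappa> \<delta> z t s * pert_phi \<kappa> \<delta> z s \<partial>M)"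
    if "t \<in> {0..l}" for t
    using T.transported_phi_volterra[OF that, of z] by (simp add: pert_kernel_def)
  show "string_F l (pert \<kappa> \<delta>) z
      = 1 - (\<integral>s. green_kernel l z 0 (y \<delta> s) * complex_of_real (w \<kappa> s) * pert_phi \<kappa> \<delta> z s \<partial>M)"
    using T.string_F_image[of z] by simp
  show "is_string l (pert \<kappa> \<delta>)" using T.is_string_image by simp
  show "total_mass (pert \<kappa> \<delta>) = (\<integral>s. w \<kappa> s \<partial>M)" using T.total_mass_image_string by simp
qed

lemma max_y_diff_le:
  assumes "\<bar>\<delta>\<bar> \<le> 1/2"
  shows "max 0 (y \<delta> t - y \<delta> s) \<le> 2 * max 0 (t - s)"
proof (cases "t \<le> s")
  case False
  then show ?thesis using y_diff[OF assms, of s t] by simp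
qed (use y_mono[OF assms, of t s] in auto)

lemma norm_pert_kernel_le:
  assumes "small \<kappa> \<delta>" "norm z \<le> Z" "s \<in> {0..l}"
  shows "norm (pert_kernel \<kappa> \<delta> z t s) \<le> (4 * Z\<^sup>2) * max 0 (t - s)"
proof -
  have "norm (pert_kernel \<kappa> \<delta> z t s) = (norm z)\<^sup>2 * (max 0 (y \<delta> t - y \<delta> s) * w \<kappa> s)"
    unfolding pert_kernel_def norm_mult norm_power norm_of_real
    using w_bounds[of \<kappa> s] assms by (simp add: abs_mult small_def)
  also have "\<dots> \<le> Z\<^sup>2 * ((2 * max 0 (t - s)) * 2)"
    using assms w_bounds[of \<kappa> s] max_y_diff_le[of \<delta>]
    by (intro mult_mono power_mono mult_nonneg_nonneg) (auto simp: small_def)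
  finally show ?thesis by simp
qed

lemma pert_kernel_lipschitz:
  assumes sm: "small \<kappa> \<delta>" "small \<kappa>' \<delta>'" and z: "norm z \<le> Z" "norm z' \<le> Z"
    and t: "t \<in> {0..l}" and s: "s \<in> {0..l}"
  shows "norm (pert_kernel \<kappa> \<delta> z t s - pert_kernel \<kappa>' \<delta>' z' t s)
    \<le> (8 * Z * l + 2 * Z\<^sup>2 * l + 2 * Z\<^sup>2 * l * l) * (\<bar>\<kappa> - \<kappa>'\<bar> + \<bar>\<delta> - \<delta>'\<bar> + norm (z - z'))"
proof -
  define A where "A = max 0 (y \<delta> t - y \<delta> s)"
  define A' where "A' = max 0 (y \<delta>' t - y \<delta>' s)"
  have Z: "0 \<le> Z" using z(1) norm_ge_zero order_trans by blast
  have A: "\<bar>A\<bar> \<le> 2 * l" "\<bar>A'\<bar> \<le> 2 * l"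
  proof -
    have "2 * max 0 (t - s) \<le> 2 * l" using t s by auto
    then show "\<bar>A\<bar> \<le> 2 * l" "\<bar>A'\<bar> \<le> 2 * l"
      using max_y_diff_le[of \<delta> t s] max_y_diff_le[of \<delta>' t s] sm unfolding A_def A'_def small_def by linarith+
  qed
  have w: "\<bar>w \<kappa> s\<bar> \<le> 2" using w_bounds[of \<kappa> s] sm s by (simp add: small_def)
  have "\<bar>A - A'\<bar> \<le> \<bar>(\<delta> - \<delta>') * (bump t - bump s)\<bar>"
    unfolding A_def A'_def y_def by (simp add: algebra_simps)
  also have "\<dots> \<le> \<bar>\<delta> - \<delta>'\<bar> * l"
    unfolding abs_mult using bump_le[OF t] bump_le[OF s] bump_nonneg[of t] bump_nonneg[of s]
    by (intro mult_left_mono) auto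
  finally have AA: "\<bar>A - A'\<bar> \<le> \<bar>\<delta> - \<delta>'\<bar> * l" .
  have "w \<kappa> s - w \<kappa>' s = (\<kappa> - \<kappa>') * bump s" by (simp add: w_def algebra_simps)
  then have ww: "\<bar>w \<kappa> s - w \<kappa>' s\<bar> \<le> \<bar>\<kappa> - \<kappa>'\<bar> * l"
    using bump_le[OF s] bump_nonneg[of s] by (simp add: abs_mult mult_left_mono)
  have "norm (z\<^sup>2 - z'\<^sup>2) = norm (z - z') * norm (z + z')"
    by (simp add: power2_eq_square square_diff_square_factored norm_mult mult.commute)
  also have "\<dots> \<le> norm (z - z') * (2 * Z)"
    using z norm_triangle_ineq[of z z'] by (intro mult_left_mono) auto
  finally have zz: "norm (z\<^sup>2 - z'\<^sup>2) \<le> norm (z - z') * (2 * Z)" .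
  have z'2: "norm (z'\<^sup>2) \<le> Z\<^sup>2" using z(2) by (simp add: norm_power power_mono)
  \<comment> \<open>The three factors of the kernel are changed one at a time. The coefficients of
    the constant belong in order to the change of z, of \<delta> and of \<kappa>.\<close>
  have "pert_kernel \<kappa> \<delta> z t s - pert_kernel \<kappa>' \<delta>' z' t s
      = (z\<^sup>2 - z'\<^sup>2) * complex_of_real (A * w \<kappa> s) + z'\<^sup>2 * complex_of_real ((A - A') * w \<kappa> s)
        + z'\<^sup>2 * complex_of_real (A' * (w \<kappa> s - w \<kappa>' s))"
    unfolding pert_kernel_def A_def[symmetric] A'_def[symmetric] by (simp add: algebra_simps)
  also have "norm \<dots> \<le> norm ((z\<^sup>2 - z'\<^sup>2) * complex_of_real (A * w \<kappa> s))
      + norm (z'\<^sup>2 * complex_of_real ((A - A') * w \<kappa> s)) + norm (z'\<^sup>2 * complex_of_real (A' * (w \<kappa> s - w \<kappa>' s)))"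
    by (intro order_trans[OF norm_triangle_ineq] add_right_mono norm_triangle_ineq)
  also have "\<dots> \<le> (norm (z - z') * (2 * Z)) * ((2 * l) * 2) + Z\<^sup>2 * ((\<bar>\<delta> - \<delta>'\<bar> * l) * 2)
      + Z\<^sup>2 * ((2 * l) * (\<bar>\<kappa> - \<kappa>'\<bar> * l))"
    unfolding norm_mult[of "z\<^sup>2 - z'\<^sup>2"] norm_mult[of "z'\<^sup>2"] norm_of_real abs_mult
    by (intro add_mono mult_mono zz z'2 A AA ww w mult_nonneg_nonneg) (use l_pos Z in auto)
  also have "\<dots> = (8 * Z * l) * norm (z - z') + (2 * Z\<^sup>2 * l) * \<bar>\<delta> - \<delta>'\<bar> + (2 * Z\<^sup>2 * l * l) * \<bar>\<kappa> - \<kappa>'\<bar>"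
    by simp
  also have "\<dots> \<le> (8 * Z * l) * (\<bar>\<kappa> - \<kappa>'\<bar> + \<bar>\<delta> - \<delta>'\<bar> + norm (z - z'))
      + (2 * Z\<^sup>2 * l) * (\<bar>\<kappa> - \<kappa>'\<bar> + \<bar>\<delta> - \<delta>'\<bar> + norm (z - z'))
      + (2 * Z\<^sup>2 * l * l) * (\<bar>\<kappa> - \<kappa>'\<bar> + \<bar>\<delta> - \<delta>'\<bar> + norm (z - z'))"
    using l_pos Z by (intro add_mono mult_left_mono mult_nonneg_nonneg) auto
  finally show ?thesis by (simp only: distrib_right)
qed

text \<open>All kernels of the family are dominated by
  \<open>(4 * Z\<^sup>2) * max 0 (t - s)\<close>, where 4 collects a factor 2 from
  \<open>y \<delta>\<close> and a factor 2 from the density. The Volterra bounds depend only on this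
  domination, so \<open>E\<close> and \<open>L\<close> are uniform.\<close>

lemma pert_phi_estimates:
  assumes Z: "0 \<le> Z"
  obtains E L where "0 < E" "0 \<le> L"
    "\<And>\<kappa> \<delta> z t. small \<kappa> \<delta> \<Longrightarrow> norm z \<le> Z \<Longrightarrow> t \<in> {0..l} \<Longrightarrow> norm (pert_phi \<kappa> \<delta> z t) \<le> E"
    "\<And>\<kappa> \<delta> z \<kappa>' \<delta>' z' t. small \<kappa> \<delta> \<Longrightarrow> small \<kappa>' \<delta>' \<Longrightarrow> norm z \<le> Z \<Longrightarrow> norm z' \<le> Z \<Longrightarrow> t \<in> {0..l}
      \<Longrightarrow> norm (pert_phi \<kappa> \<delta> z t - pert_phi \<kappa>' \<delta>' z' t) \<le> L * (\<bar>\<kappa> - \<kappa>'\<bar> + \<bar>\<delta> - \<delta>'\<bar> + norm (z - z'))"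
proof -
  define c where "c = 4 * Z\<^sup>2"
  define E where "E = 2 * exp ((2 * c * measure M {0..l} + 1) * l)"
  define K where "K = 8 * Z * l + 2 * Z\<^sup>2 * l + 2 * Z\<^sup>2 * l * l"
  have K: "0 \<le> K" using Z l_pos by (simp add: K_def)
  have c: "0 \<le> c" by (simp add: c_def)
  have meas: "pert_kernel \<kappa> \<delta> z t \<in> borel_measurable M" for \<kappa> \<delta> z t
    unfolding pert_kernel_def by measurable
  show ?thesis
  proof (rule that)
    show "0 < E" by (simp add: E_def)
    show "0 \<le> measure M {0..l} * E\<^sup>2 * K" using K by simp
    fix \<kappa> \<delta> t :: real and z :: complex assume sm: "small \<kappa> \<delta>" and z: "norm z \<le> Z" and t: "t \<in> {0..l}"
    obtain B where B: "\<And>s. s \<in> {0..l} \<Longrightarrow> norm (pert_phi \<kappa> \<delta> z s) \<le> B"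
      using pert_phi_facts(2)[OF sm] by blast
    show "norm (pert_phi \<kappa> \<delta> z t) \<le> E"
      unfolding E_def c_def
      by (rule volterra_bound[OF pert_phi_facts(1)[OF sm] B norm_pert_kernel_le[OF sm z] _ pert_phi_facts(3)[OF sm] t]) auto
    fix \<kappa>' \<delta>' :: real and z' :: complex assume sm': "small \<kappa>' \<delta>'" and z': "norm z' \<le> Z"
    obtain B' where B': "\<And>s. s \<in> {0..l} \<Longrightarrow> norm (pert_phi \<kappa>' \<delta>' z' s) \<le> B'"
      using pert_phi_facts(2)[OF sm'] by blast
    have "norm (pert_phi \<kappa> \<delta> z t - pert_phi \<kappa>' \<delta>' z' t)
       \<le> measure M {0..l} * (2 * exp ((2 * c * measure M {0..l} + 1) * l))\<^sup>2 * (K * (\<bar>\<kappa> - \<kappa>'\<bar> + \<bar>\<delta> - \<delta>'\<bar> + norm (z - z')))"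
    proof (rule volterra_stability[where K = "pert_kernel \<kappa> \<delta> z" and K' = "pert_kernel \<kappa>' \<delta>' z'" and B = B and B' = B'])
      show "norm (pert_kernel \<kappa> \<delta> z t s - pert_kernel \<kappa>' \<delta>' z' t s) \<le> K * (\<bar>\<kappa> - \<kappa>'\<bar> + \<bar>\<delta> - \<delta>'\<bar> + norm (z - z'))"
        if "t \<in> {0..l}" "s \<in> {0..l}" for t s
        unfolding K_def by (rule pert_kernel_lipschitz[OF sm sm' z z' that])
      show "norm (pert_kernel \<kappa> \<delta> z t s) \<le> c * max 0 (t - s)" if "t \<in> {0..l}" "s \<in> {0..l}" for t s
        unfolding c_def by (rule norm_pert_kernel_le[OF sm z that(2)])
      show "norm (pert_kernel \<kappa>' \<delta>' z' t s) \<le> c * max 0 (t - s)" if "t \<in> {0..l}" "s \<in> {0..l}" for t s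
        unfolding c_def by (rule norm_pert_kernel_le[OF sm' z' that(2)])
      show "0 \<le> K * (\<bar>\<kappa> - \<kappa>'\<bar> + \<bar>\<delta> - \<delta>'\<bar> + norm (z - z'))" by (intro mult_nonneg_nonneg K) auto
    qed (use pert_phi_facts(1,3) sm sm' B B' meas c t in \<open>assumption | simp\<close>)+
    then show "norm (pert_phi \<kappa> \<delta> z t - pert_phi \<kappa>' \<delta>' z' t)
      \<le> (measure M {0..l} * E\<^sup>2 * K) * (\<bar>\<kappa> - \<kappa>'\<bar> + \<bar>\<delta> - \<delta>'\<bar> + norm (z - z'))"
      by (simp add: E_def mult.assoc)
  qed
qed

end

lemma (in krein_string) pair_integrable_bounded:
  fixes f :: "real \<times> real \<Rightarrow> 'c::{banach, second_countable_topology}"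
  assumes "f \<in> borel_measurable (M \<Otimes>\<^sub>M M)"
    and "\<And>x y. x \<in> {0..l} \<Longrightarrow> y \<in> {0..l} \<Longrightarrow> norm (f (x, y)) \<le> B"
  shows "integrable (M \<Otimes>\<^sub>M M) f"
  using assms by (intro integrable_pair_bounded[where B = B] finite_measure_axioms) auto

lemma (in krein_string) norm_pair_integral_le:
  fixes f :: "real \<times> real \<Rightarrow> 'c::{banach, second_countable_topology}"
  assumes "\<And>x y. x \<in> {0..l} \<Longrightarrow> y \<in> {0..l} \<Longrightarrow> norm (f (x, y)) \<le> B" "0 \<le> B"
  shows "norm (\<integral>p. f p \<partial>(M \<Otimes>\<^sub>M M)) \<le> measure (M \<Otimes>\<^sub>M M) ({0..l} \<times> {0..l}) * B"
proof -
  interpret P: finite_measure "M \<Otimes>\<^sub>M M"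
    by (intro finite_measure_pair_measure finite_measure_axioms)
  have "norm (\<integral>p. f p \<partial>(M \<Otimes>\<^sub>M M)) \<le> (\<integral>p. norm (f p) \<partial>(M \<Otimes>\<^sub>M M))" by (rule integral_norm_bound)
  also have "\<dots> \<le> (\<integral>p. B \<partial>(M \<Otimes>\<^sub>M M))"
    using assms by (intro integral_mono') (auto simp: space_pair_measure)
  finally show ?thesis by (simp add: space_pair_measure)
qed

section \<open>First-order expansion of F at the quasi-eigenvalue and its continuity in the
  parameters\<close>

context bumped_string begin

text \<open>In the duality identity the difference of the kernels is already of first order, so
  replacing the perturbed solution by \<phi> costs only second order in the parameters, apart from
  terms of order \<eta>. No derivative in z is taken: the shift \<eta> is put into the error, which
  is affordable because \<eta> can be chosen after the size of the parameters.\<close>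

lemma string_F_pert_expansion:
  assumes F: "string_F l M \<omega> = 0"
  defines "\<phi> \<equiv> string_phi l M \<omega>"
  obtains K where "0 \<le> K"
    "\<And>\<kappa> \<delta> \<eta>. small \<kappa> \<delta> \<Longrightarrow> 0 \<le> \<eta> \<Longrightarrow> \<eta> \<le> 1 \<Longrightarrow> \<bar>\<kappa>\<bar> + \<bar>\<delta>\<bar> \<le> 1 \<Longrightarrow>
      norm (string_F l (pert \<kappa> \<delta>) (\<omega> + \<i> * complex_of_real \<eta>) * (\<integral>s. \<phi> s \<partial>M)
         + (complex_of_real \<kappa> * (\<integral>s. complex_of_real (bump s) * (\<phi> s)\<^sup>2 \<partial>M)
            - \<omega>\<^sup>2 * complex_of_real \<delta> * (\<integral>(t, s). \<phi> t * \<phi> s * complex_of_real (bump (max t s)) \<partial>(M \<Otimes>\<^sub>M M))))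
      \<le> K * (\<eta> + (\<bar>\<kappa>\<bar> + \<bar>\<delta>\<bar>)\<^sup>2)"
proof -
  interpret P: pair_sigma_finite M M ..
  define Z where "Z = norm \<omega> + 1"
  have Z: "0 \<le> Z" "norm \<omega> \<le> Z" by (simp_all add: Z_def)
  obtain E L where E: "0 < E" and L: "0 \<le> L"
    and pE: "\<And>\<kappa> \<delta> z t. small \<kappa> \<delta> \<Longrightarrow> norm z \<le> Z \<Longrightarrow> t \<in> {0..l} \<Longrightarrow> norm (pert_phi \<kappa> \<delta> z t) \<le> E"
    and pL: "\<And>\<kappa> \<delta> z \<kappa>' \<delta>' z' t. small \<kappa> \<delta> \<Longrightarrow> small \<kappa>' \<delta>' \<Longrightarrow> norm z \<le> Z \<Longrightarrow> norm z' \<le> Z \<Longrightarrow> t \<in> {0..l}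
      \<Longrightarrow> norm (pert_phi \<kappa> \<delta> z t - pert_phi \<kappa>' \<delta>' z' t) \<le> L * (\<bar>\<kappa> - \<kappa>'\<bar> + \<bar>\<delta> - \<delta>'\<bar> + norm (z - z'))"
    using pert_phi_estimates[OF Z(1)] by blast
  have sm0: "small 0 0" by (simp add: small_def)
  have \<phi>_pert: "\<phi> = pert_phi 0 0 \<omega>"
    by (simp add: \<phi>_def fun_eq_iff pert_phi_def pert_00 y_def)
  have \<phi>E: "norm (\<phi> t) \<le> E" if "t \<in> {0..l}" for t
    unfolding \<phi>_pert by (rule pE[OF sm0 Z(2) that])
  have [measurable]: "\<phi> \<in> borel_measurable M" unfolding \<phi>_def by measurable
  have \<phi>_green: "\<phi> t = (\<integral>s. green_kernel l \<omega> t s * \<phi> s \<partial>M)" if "t \<in> {0..l}" for t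
    using string_phi_eq_green[OF that, of \<omega>] by (simp add: F \<phi>_def)
  define H where "H = green_kernel l \<omega>"
  define Z1 where "Z1 = Z\<^sup>2 * l + Z"
  have Z1: "0 \<le> Z1" using Z l_pos by (simp add: Z1_def)
  have H_le: "norm (H t s) \<le> Z1" if "t \<in> {0..l}" "s \<in> {0..l}" for t s
  proof -
    have "norm (H t s) \<le> (norm \<omega>)\<^sup>2 * l + norm \<omega>"
      unfolding H_def by (rule norm_green_kernel_le[OF that])
    also have "\<dots> \<le> Z1" unfolding Z1_def
      using Z l_pos by (intro add_mono mult_right_mono power_mono) auto
    finally show ?thesis .
  qed
  have [measurable]: "(\<lambda>p. H (f p) (g p)) \<in> borel_measurable N"
    if "f \<in> borel_measurable N" "g \<in> borel_measurable N" for f g and N :: "(real \<times> real) measure"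
    unfolding H_def using that by measurable
  have bumpm: "0 \<le> bump (max t s)" "bump (max t s) \<le> l" if "t \<in> {0..l}" "s \<in> {0..l}" for t s
    using bump_nonneg bump_le[of "max t s"] that by auto
  define G where "G = (\<integral>s. complex_of_real (bump s) * (\<phi> s)\<^sup>2 \<partial>M)"
  define C where "C = (\<integral>(t, s). \<phi> t * \<phi> s * complex_of_real (bump (max t s)) \<partial>(M \<Otimes>\<^sub>M M))"
  \<comment> \<open>The part of \<open>H' - H\<close> that is linear in \<kappa> and \<delta>; the
    first term comes from the density, the second from the displacement.\<close>
  define Q where "Q \<kappa> \<delta> t s = complex_of_real (\<kappa> * bump s) * H t s - \<omega>\<^sup>2 * complex_of_real (\<delta> * bump (max t s))"
    for \<kappa> \<delta> t s
  define K2 where "K2 = l * Z1 + Z\<^sup>2 * l"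
  have K2: "0 \<le> K2" using Z Z1 l_pos by (simp add: K2_def)
  have Q_le: "norm (Q \<kappa> \<delta> t s) \<le> K2 * (\<bar>\<kappa>\<bar> + \<bar>\<delta>\<bar>)" if ts: "t \<in> {0..l}" "s \<in> {0..l}" for \<kappa> \<delta> t s
  proof -
    have "norm (Q \<kappa> \<delta> t s) \<le> norm (complex_of_real (\<kappa> * bump s) * H t s) + norm (\<omega>\<^sup>2 * complex_of_real (\<delta> * bump (max t s)))"
      unfolding Q_def by (rule norm_triangle_ineq4)
    also have "\<dots> \<le> (\<bar>\<kappa>\<bar> * l) * Z1 + Z\<^sup>2 * (\<bar>\<delta>\<bar> * l)"
      unfolding norm_mult norm_of_real abs_mult norm_power using bump_le[OF ts(2)] bump_nonneg[of s] bumpm[OF ts] Z Z1 l_pos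
      by (intro add_mono mult_mono H_le[OF ts] power_mono) auto
    also have "\<dots> = (l * Z1) * \<bar>\<kappa>\<bar> + (Z\<^sup>2 * l) * \<bar>\<delta>\<bar>" by simp
    also have "\<dots> \<le> (l * Z1) * (\<bar>\<kappa>\<bar> + \<bar>\<delta>\<bar>) + (Z\<^sup>2 * l) * (\<bar>\<kappa>\<bar> + \<bar>\<delta>\<bar>)"
      using Z1 l_pos by (intro add_mono mult_left_mono) auto
    finally show ?thesis by (simp only: K2_def distrib_right)
  qed
  have Q_int: "integrable (M \<Otimes>\<^sub>M M) (\<lambda>(t, s). \<phi> t * (Q \<kappa> \<delta> t s * \<phi> s))" for \<kappa> \<delta>
  proof (rule pair_integrable_bounded)
    show "(\<lambda>(t, s). \<phi> t * (Q \<kappa> \<delta> t s * \<phi> s)) \<in> borel_measurable (M \<Otimes>\<^sub>M M)"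
      unfolding Q_def by measurable
    fix t s assume ts: "t \<in> {0..l}" "s \<in> {0..l}"
    show "norm (case (t, s) of (t, s) \<Rightarrow> \<phi> t * (Q \<kappa> \<delta> t s * \<phi> s)) \<le> E * ((K2 * (\<bar>\<kappa>\<bar> + \<bar>\<delta>\<bar>)) * E)"
      unfolding prod.case norm_mult using E K2 ts by (intro mult_mono \<phi>E Q_le) auto
  qed
  have Q_integral: "(\<integral>(t, s). \<phi> t * (Q \<kappa> \<delta> t s * \<phi> s) \<partial>(M \<Otimes>\<^sub>M M))
      = complex_of_real \<kappa> * G - \<omega>\<^sup>2 * complex_of_real \<delta> * C" for \<kappa> \<delta>
  proof -
    have intG: "integrable (M \<Otimes>\<^sub>M M) (\<lambda>(t, s). \<phi> t * ((complex_of_real (bump s) * H t s) * \<phi> s))"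
    proof (rule pair_integrable_bounded)
      fix t s assume ts: "t \<in> {0..l}" "s \<in> {0..l}"
      show "norm (case (t, s) of (t, s) \<Rightarrow> \<phi> t * ((complex_of_real (bump s) * H t s) * \<phi> s)) \<le> E * ((l * Z1) * E)"
        unfolding prod.case norm_mult norm_of_real
        using E Z1 ts l_pos bump_le[OF ts(2)] bump_nonneg[of s] by (intro mult_mono \<phi>E H_le) auto
    qed measurable
    have intC: "integrable (M \<Otimes>\<^sub>M M) (\<lambda>(t, s). \<phi> t * \<phi> s * complex_of_real (bump (max t s)))"
    proof (rule pair_integrable_bounded)
      fix t s assume ts: "t \<in> {0..l}" "s \<in> {0..l}"
      show "norm (case (t, s) of (t, s) \<Rightarrow> \<phi> t * \<phi> s * complex_of_real (bump (max t s))) \<le> (E * E) * l"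
        unfolding prod.case norm_mult norm_of_real
        using E ts l_pos bumpm[OF ts] by (intro mult_mono \<phi>E) auto
    qed measurable
    \<comment> \<open>Integrating over t first, the symmetric kernel reproduces \<phi> at s, because
      \<open>F\<close> vanishes. The density term thereby collapses to a single integral of \<phi>
      squared.\<close>
    have "(\<integral>(t, s). \<phi> t * ((complex_of_real (bump s) * H t s) * \<phi> s) \<partial>(M \<Otimes>\<^sub>M M))
       = (\<integral>s. (\<integral>t. \<phi> t * ((complex_of_real (bump s) * H t s) * \<phi> s) \<partial>M) \<partial>M)"
      using P.integral_snd[OF intG] by simp
    also have "\<dots> = G" unfolding G_def
    proof (rule Bochner_Integration.integral_cong[OF refl])
      fix s assume "s \<in> space M"
      then have "(\<integral>t. H s t * \<phi> t \<partial>M) = \<phi> s" using \<phi>_green[of s] by (simp add: H_def)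
      have "(\<integral>t. \<phi> t * ((complex_of_real (bump s) * H t s) * \<phi> s) \<partial>M)
        = (\<integral>t. (complex_of_real (bump s) * \<phi> s) * (H s t * \<phi> t) \<partial>M)"
        unfolding H_def by (subst green_kernel_commute) (simp add: mult_ac)
      also have "\<dots> = (complex_of_real (bump s) * \<phi> s) * (\<integral>t. H s t * \<phi> t \<partial>M)"
        by (rule integral_mult_right_zero)
      finally show "(\<integral>t. \<phi> t * ((complex_of_real (bump s) * H t s) * \<phi> s) \<partial>M) = complex_of_real (bump s) * (\<phi> s)\<^sup>2"
        using \<open>(\<integral>t. H s t * \<phi> t \<partial>M) = \<phi> s\<close> by (simp add: power2_eq_square)
    qed
    finally have GI: "(\<integral>(t, s). \<phi> t * ((complex_of_real (bump s) * H t s) * \<phi> s) \<partial>(M \<Otimes>\<^sub>M M)) = G" .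
    have "(\<integral>(t, s). \<phi> t * (Q \<kappa> \<delta> t s * \<phi> s) \<partial>(M \<Otimes>\<^sub>M M))
       = (\<integral>p. complex_of_real \<kappa> * (case p of (t, s) \<Rightarrow> \<phi> t * ((complex_of_real (bump s) * H t s) * \<phi> s))
            - (\<omega>\<^sup>2 * complex_of_real \<delta>) * (case p of (t, s) \<Rightarrow> \<phi> t * \<phi> s * complex_of_real (bump (max t s))) \<partial>(M \<Otimes>\<^sub>M M))"
      by (rule Bochner_Integration.integral_cong) (auto simp: Q_def algebra_simps)
    also have "\<dots> = complex_of_real \<kappa> * G - (\<omega>\<^sup>2 * complex_of_real \<delta>) * C"
      using intG intC unfolding C_def GI[symmetric]
      by (subst Bochner_Integration.integral_diff) auto
    finally show ?thesis .
  qed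
  define m2 where "m2 = measure (M \<Otimes>\<^sub>M M) ({0..l} \<times> {0..l})"
  define K3 where "K3 = 2 * (2 * Z * l + 1) + Z\<^sup>2 * (l * l)"
  have K3: "0 \<le> K3" using Z l_pos by (simp add: K3_def)
  have K23: "0 \<le> K3 * E + K2 * L" using E K2 K3 L by simp
  show ?thesis
  proof (rule that)
    show "0 \<le> m2 * (E * (K3 * E + K2 * L))" using E K23 by (simp add: m2_def)
    fix \<kappa> \<delta> \<eta> :: real
    assume sm: "small \<kappa> \<delta>" and \<eta>: "0 \<le> \<eta>" "\<eta> \<le> 1" and p1: "\<bar>\<kappa>\<bar> + \<bar>\<delta>\<bar> \<le> 1"
    define p where "p = \<bar>\<kappa>\<bar> + \<bar>\<delta>\<bar>"
    define z' where "z' = \<omega> + \<i> * complex_of_real \<eta>"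
    have p: "0 \<le> p" "p \<le> 1" using p1 by (simp_all add: p_def)
    have z'\<omega>: "norm (z' - \<omega>) = \<eta>" using \<eta> by (simp add: z'_def norm_mult)
    have "norm z' \<le> norm \<omega> + norm (\<i> * complex_of_real \<eta>)" unfolding z'_def by (rule norm_triangle_ineq)
    then have z': "norm z' \<le> Z" using \<eta> by (simp add: Z_def norm_mult)
    define u where "u = pert_phi \<kappa> \<delta> z'"
    have u_meas [measurable]: "u \<in> borel_measurable M" unfolding u_def by (rule pert_phi_facts(1)[OF sm])
    have u_le: "norm (u s) \<le> E" if "s \<in> {0..l}" for s unfolding u_def by (rule pE[OF sm z' that])
    have u\<phi>: "norm (u s - \<phi> s) \<le> L * (p + \<eta>)" if "s \<in> {0..l}" for s
      using pL[OF sm sm0 z' Z(2) that] unfolding u_def \<phi>_pert z'\<omega> p_def by simp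
    interpret T: transported_string l M "w \<kappa>" "y \<delta>" 2 by (rule transported[OF sm])
    have [simp]: "T.image_string = pert \<kappa> \<delta>" by (simp add: T.image_string_def pert_def)
    have [simp]: "T.transported_phi z' = u"
      by (simp add: fun_eq_iff T.transported_phi_def pert_phi_def u_def)
    define H' where "H' t s = green_kernel l z' (y \<delta> t) (y \<delta> s) * complex_of_real (w \<kappa> s)" for t s
    have dual: "string_F l (pert \<kappa> \<delta>) z' * (\<integral>s. \<phi> s \<partial>M) = (\<integral>(t, s). \<phi> t * ((H t s - H' t s) * u s) \<partial>(M \<Otimes>\<^sub>M M))"
      using T.string_F_duality[OF F, of z'] by (simp add: \<phi>_def H_def H'_def)
    have T1: "norm (H t s - H' t s + Q \<kappa> \<delta> t s) \<le> K3 * (\<eta> + p\<^sup>2)" if ts: "t \<in> {0..l}" "s \<in> {0..l}" for t s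
    proof -
      define x where "x = max t s"
      have x: "x \<in> {0..l}" using ts by (auto simp: x_def max_def)
      have d: "\<bar>\<delta>\<bar> \<le> 1/2" "\<bar>\<kappa>\<bar> * l \<le> 1/2" using sm by (simp_all add: small_def)
      have yx: "y \<delta> x \<in> {0..l}" by (rule y_in_interval[OF d(1) x])
      define D where "D = (z'\<^sup>2 - \<omega>\<^sup>2) * complex_of_real (l - y \<delta> x) + \<i> * (z' - \<omega>)"
      have "norm (z'\<^sup>2 - \<omega>\<^sup>2) = norm (z' - \<omega>) * norm (z' + \<omega>)"
        by (simp add: power2_eq_square square_diff_square_factored norm_mult mult.commute)
      also have "\<dots> \<le> \<eta> * (2 * Z)"
        unfolding z'\<omega> using \<eta> Z z' norm_triangle_ineq[of z' \<omega>] by (intro mult_left_mono) auto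
      finally have zz: "norm (z'\<^sup>2 - \<omega>\<^sup>2) \<le> \<eta> * (2 * Z)" .
      have "norm D \<le> norm ((z'\<^sup>2 - \<omega>\<^sup>2) * complex_of_real (l - y \<delta> x)) + norm (\<i> * (z' - \<omega>))"
        unfolding D_def by (rule norm_triangle_ineq)
      also have "\<dots> \<le> (\<eta> * (2 * Z)) * l + \<eta>"
        unfolding norm_mult norm_of_real norm_ii mult_1 z'\<omega> using yx \<eta> Z
        by (intro add_right_mono mult_mono zz) auto
      finally have D: "norm D \<le> (2 * Z * l + 1) * \<eta>" by (simp add: algebra_simps)
      have y_x: "y \<delta> x = x + \<delta> * bump x" by (simp add: y_def)
      \<comment> \<open>An exact identity: beyond the linear part there remain only
        \<open>D\<close>, the effect of moving \<omega> to z', and the mixed term in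
        \<open>\<kappa> * \<delta>\<close>.\<close>
      have "H t s - H' t s + Q \<kappa> \<delta> t s = - (D * complex_of_real (w \<kappa> s)) + \<omega>\<^sup>2 * complex_of_real ((\<delta> * bump x) * (\<kappa> * bump s))"
        unfolding H_def H'_def Q_def green_kernel_def max_y[OF d(1)] x_def[symmetric] D_def w_def y_x
        by (simp add: algebra_simps)
      also have "norm \<dots> \<le> norm (D * complex_of_real (w \<kappa> s)) + norm (\<omega>\<^sup>2 * complex_of_real ((\<delta> * bump x) * (\<kappa> * bump s)))"
        by (rule order_trans[OF norm_triangle_ineq]) simp
      also have "norm (D * complex_of_real (w \<kappa> s)) \<le> ((2 * Z * l + 1) * \<eta>) * 2"
        unfolding norm_mult norm_of_real using w_bounds[OF d(2) ts(2)] Z \<eta> l_pos by (intro mult_mono D) auto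
      also have "norm (\<omega>\<^sup>2 * complex_of_real ((\<delta> * bump x) * (\<kappa> * bump s))) \<le> Z\<^sup>2 * ((p * l) * (p * l))"
        unfolding norm_mult norm_of_real abs_mult norm_power
        using Z l_pos p bump_le[OF x] bump_le[OF ts(2)] bump_nonneg
        by (intro mult_mono power_mono mult_nonneg_nonneg) (auto simp: p_def)
      also have "((2 * Z * l + 1) * \<eta>) * 2 + Z\<^sup>2 * ((p * l) * (p * l)) = (2 * (2 * Z * l + 1)) * \<eta> + (Z\<^sup>2 * (l * l)) * p\<^sup>2"
        by (simp add: power2_eq_square)
      also have "\<dots> \<le> (2 * (2 * Z * l + 1)) * (\<eta> + p\<^sup>2) + (Z\<^sup>2 * (l * l)) * (\<eta> + p\<^sup>2)"
        using Z l_pos \<eta> by (intro add_mono mult_left_mono) auto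
      finally show ?thesis by (simp add: K3_def distrib_right)
    qed
    have HH: "norm (H t s - H' t s) \<le> K3 * (\<eta> + p\<^sup>2) + K2 * p" if "t \<in> {0..l}" "s \<in> {0..l}" for t s
      using T1[OF that] Q_le[OF that, of \<kappa> \<delta>] norm_triangle_ineq4[of "H t s - H' t s + Q \<kappa> \<delta> t s" "Q \<kappa> \<delta> t s"]
      by (simp add: p_def)
    have int1: "integrable (M \<Otimes>\<^sub>M M) (\<lambda>(t, s). \<phi> t * ((H t s - H' t s) * u s))"
    proof (rule pair_integrable_bounded)
      show "(\<lambda>(t, s). \<phi> t * ((H t s - H' t s) * u s)) \<in> borel_measurable (M \<Otimes>\<^sub>M M)"
        unfolding H'_def by measurable
      fix t s assume ts: "t \<in> {0..l}" "s \<in> {0..l}"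
      show "norm (case (t, s) of (t, s) \<Rightarrow> \<phi> t * ((H t s - H' t s) * u s)) \<le> E * ((K3 * (\<eta> + p\<^sup>2) + K2 * p) * E)"
        unfolding prod.case norm_mult using E K2 K3 \<eta> p ts by (intro mult_mono \<phi>E HH u_le) auto
    qed
    have "string_F l (pert \<kappa> \<delta>) z' * (\<integral>s. \<phi> s \<partial>M) + (complex_of_real \<kappa> * G - \<omega>\<^sup>2 * complex_of_real \<delta> * C)
       = (\<integral>q. (case q of (t, s) \<Rightarrow> \<phi> t * ((H t s - H' t s) * u s)) + (case q of (t, s) \<Rightarrow> \<phi> t * (Q \<kappa> \<delta> t s * \<phi> s)) \<partial>(M \<Otimes>\<^sub>M M))"
      unfolding dual Q_integral[symmetric] by (rule Bochner_Integration.integral_add[symmetric, OF int1 Q_int])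
    also have "norm \<dots> \<le> m2 * (E * ((K3 * E + K2 * L) * (\<eta> + p\<^sup>2)))"
      unfolding m2_def
    proof (rule norm_pair_integral_le)
      fix t s assume ts: "t \<in> {0..l}" "s \<in> {0..l}"
      \<comment> \<open>The mixed product \<open>p * \<eta>\<close> is absorbed into \<eta>, since
        \<open>p \<le> 1\<close>.\<close>
      have "p * (p + \<eta>) \<le> \<eta> + p\<^sup>2"
        using mult_right_mono[OF p(2) \<eta>(1)] by (simp add: power2_eq_square distrib_left)
      then have QL: "K2 * p * (L * (p + \<eta>)) \<le> (K2 * L) * (\<eta> + p\<^sup>2)"
        using mult_left_mono[of "p * (p + \<eta>)" "\<eta> + p\<^sup>2" "K2 * L"] K2 L by (simp add: mult_ac)
      have "(H t s - H' t s) * u s + Q \<kappa> \<delta> t s * \<phi> s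
         = (H t s - H' t s + Q \<kappa> \<delta> t s) * u s - Q \<kappa> \<delta> t s * (u s - \<phi> s)" by (simp add: algebra_simps)
      also have "norm \<dots> \<le> norm ((H t s - H' t s + Q \<kappa> \<delta> t s) * u s) + norm (Q \<kappa> \<delta> t s * (u s - \<phi> s))"
        by (rule norm_triangle_ineq4)
      also have "\<dots> \<le> (K3 * (\<eta> + p\<^sup>2)) * E + (K2 * p) * (L * (p + \<eta>))"
        unfolding norm_mult using Q_le[OF ts, of \<kappa> \<delta>] ts K2 K3 \<eta> p
        by (intro add_mono mult_mono T1 u_le u\<phi>) (auto simp: p_def)
      also have "\<dots> \<le> (K3 * E + K2 * L) * (\<eta> + p\<^sup>2)" using QL by (simp add: algebra_simps)
      finally have "norm ((H t s - H' t s) * u s + Q \<kappa> \<delta> t s * \<phi> s) \<le> (K3 * E + K2 * L) * (\<eta> + p\<^sup>2)" .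
      then have "norm (\<phi> t * ((H t s - H' t s) * u s + Q \<kappa> \<delta> t s * \<phi> s)) \<le> E * ((K3 * E + K2 * L) * (\<eta> + p\<^sup>2))"
        unfolding norm_mult[of "\<phi> t"] using E \<phi>E[OF ts(1)] by (intro mult_mono) auto
      then show "norm ((case (t, s) of (t, s) \<Rightarrow> \<phi> t * ((H t s - H' t s) * u s)) + (case (t, s) of (t, s) \<Rightarrow> \<phi> t * (Q \<kappa> \<delta> t s * \<phi> s)))
         \<le> E * ((K3 * E + K2 * L) * (\<eta> + p\<^sup>2))" by (simp add: distrib_left)
    qed (use E K23 \<eta> in auto)
    finally show "norm (string_F l (pert \<kappa> \<delta>) (\<omega> + \<i> * complex_of_real \<eta>) * (\<integral>s. \<phi> s \<partial>M)
         + (complex_of_real \<kappa> * (\<integral>s. complex_of_real (bump s) * (\<phi> s)\<^sup>2 \<partial>M)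
            - \<omega>\<^sup>2 * complex_of_real \<delta> * (\<integral>(t, s). \<phi> t * \<phi> s * complex_of_real (bump (max t s)) \<partial>(M \<Otimes>\<^sub>M M))))
      \<le> m2 * (E * (K3 * E + K2 * L)) * (\<eta> + (\<bar>\<kappa>\<bar> + \<bar>\<delta>\<bar>)\<^sup>2)"
      unfolding z'_def G_def C_def p_def by (simp add: mult.assoc)
  qed
qed

text \<open>Dominated convergence in the formula for \<open>F\<close> of an image string; the
  solutions converge pointwise by the uniform Lipschitz estimate. The parameters are arbitrary
  continuous functions of a complex variable because they will be the coordinates of a point of a
  disc.\<close>

lemma continuous_string_F_pert:
  fixes k d :: "complex \<Rightarrow> real"
  assumes cont: "continuous_on S k" "continuous_on S d" and sm: "\<And>q. q \<in> S \<Longrightarrow> small (k q) (d q)"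
  shows "continuous_on S (\<lambda>q. string_F l (pert (k q) (d q)) z)"
proof -
  obtain E L where E: "0 < E" and L: "0 \<le> L"
    and pE: "\<And>\<kappa> \<delta> z' t. small \<kappa> \<delta> \<Longrightarrow> norm z' \<le> norm z \<Longrightarrow> t \<in> {0..l} \<Longrightarrow> norm (pert_phi \<kappa> \<delta> z' t) \<le> E"
    and pL: "\<And>\<kappa> \<delta> z1 \<kappa>' \<delta>' z' t. small \<kappa> \<delta> \<Longrightarrow> small \<kappa>' \<delta>' \<Longrightarrow> norm z1 \<le> norm z \<Longrightarrow> norm z' \<le> norm z \<Longrightarrow> t \<in> {0..l}
      \<Longrightarrow> norm (pert_phi \<kappa> \<delta> z1 t - pert_phi \<kappa>' \<delta>' z' t) \<le> L * (\<bar>\<kappa> - \<kappa>'\<bar> + \<bar>\<delta> - \<delta>'\<bar> + norm (z1 - z'))"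
    using pert_phi_estimates[OF norm_ge_zero[of z]] by blast
  show ?thesis
  proof (rule continuous_on_sequentiallyI)
    fix X q assume X: "\<forall>n. X n \<in> S" and q: "q \<in> S" and Xq: "X \<longlonglongrightarrow> q"
    define f where "f q s = green_kernel l z 0 (y (d q) s) * complex_of_real (w (k q) s) * pert_phi (k q) (d q) z s" for q s
    have kX: "(\<lambda>n. k (X n)) \<longlonglongrightarrow> k q" and dX: "(\<lambda>n. d (X n)) \<longlonglongrightarrow> d q"
      using cont X q Xq by (auto simp: continuous_on_sequentially o_def)
    have eq: "string_F l (pert (k q) (d q)) z = 1 - (\<integral>s. f q s \<partial>M)" if "q \<in> S" for q
      using pert_phi_facts(4)[OF sm[OF that], of z] by (simp add: f_def)
    have meas: "f q \<in> borel_measurable M" if "q \<in> S" for q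
    proof -
      have [measurable]: "pert_phi (k q) (d q) z \<in> borel_measurable M"
        by (rule pert_phi_facts(1)[OF sm[OF that]])
      show ?thesis unfolding f_def by measurable
    qed
    have "(\<lambda>n. \<integral>s. f (X n) s \<partial>M) \<longlonglongrightarrow> (\<integral>s. f q s \<partial>M)"
    proof (rule integral_dominated_convergence[where w = "\<lambda>s. ((norm z)\<^sup>2 * l + norm z) * 2 * E"])
      show "AE s in M. (\<lambda>n. f (X n) s) \<longlonglongrightarrow> f q s"
      proof (rule AE_I2)
        fix s assume "s \<in> space M"
        then have s: "s \<in> {0..l}" by simp
        have "(\<lambda>n. pert_phi (k (X n)) (d (X n)) z s) \<longlonglongrightarrow> pert_phi (k q) (d q) z s"
        proof (rule Lim_transform_bound[THEN LIM_zero_cancel, rotated])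
          show "(\<lambda>n. L * (\<bar>k (X n) - k q\<bar> + \<bar>d (X n) - d q\<bar> + norm (z - z))) \<longlonglongrightarrow> 0"
            by (rule tendsto_eq_intros kX dX refl | simp)+
          show "\<forall>\<^sub>F n in sequentially. norm (pert_phi (k (X n)) (d (X n)) z s - pert_phi (k q) (d q) z s)
             \<le> norm (L * (\<bar>k (X n) - k q\<bar> + \<bar>d (X n) - d q\<bar> + norm (z - z)))"
            using pL[OF sm sm order_refl order_refl s] X q L by (intro always_eventually) fastforce
        qed
        then show "(\<lambda>n. f (X n) s) \<longlonglongrightarrow> f q s"
          unfolding f_def green_kernel_def y_def w_def by (intro tendsto_intros kX dX)
      qed
      show "AE s in M. norm (f (X n) s) \<le> ((norm z)\<^sup>2 * l + norm z) * 2 * E" for n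
      proof (rule AE_I2)
        fix s assume "s \<in> space M"
        then have s: "s \<in> {0..l}" by simp
        have sn: "small (k (X n)) (d (X n))" using sm X by blast
        show "norm (f (X n) s) \<le> ((norm z)\<^sup>2 * l + norm z) * 2 * E"
          unfolding f_def norm_mult norm_of_real
          using sn w_bounds[of "k (X n)" s] y_in_interval[of "d (X n)" s] s l_pos
          by (intro mult_mono norm_green_kernel_le pE) (auto simp: small_def)
      qed
    qed (use meas X q in auto)
    then have "(\<lambda>n. 1 - (\<integral>s. f (X n) s \<partial>M)) \<longlonglongrightarrow> 1 - (\<integral>s. f q s \<partial>M)"
      by (intro tendsto_intros)
    then show "(\<lambda>n. string_F l (pert (k (X n)) (d (X n))) z) \<longlonglongrightarrow> string_F l (pert (k q) (d q)) z"
      using X q by (simp add: eq)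
  qed
qed

end

subsection \<open>Moving a quasi-eigenvalue upwards\<close>

text \<open>A fixed point of \<open>q - \<Psi> q\<close>, which maps the disc into itself, is a zero
  of \<Psi>. Brouwer's theorem supplies it from continuity alone.\<close>

lemma complex_zero_near_identity:
  fixes \<Psi> :: "complex \<Rightarrow> complex"
  assumes "0 < r" "continuous_on (cball 0 r) \<Psi>" "\<And>q. norm q \<le> r \<Longrightarrow> norm (q - \<Psi> q) \<le> r"
  obtains q where "norm q \<le> r" "\<Psi> q = 0"
proof -
  have "\<exists>q\<in>cball 0 r. q - \<Psi> q = q"
    by (rule brouwer_ball[OF assms(1), where f = "\<lambda>q. q - \<Psi> q"]) (use assms(2,3) in \<open>auto intro!: continuous_intros\<close>)
  then show ?thesis using that by auto
qed

text \<open>Cramer's rule: \<open>Im (cnj e1 * e2)\<close> is the determinant of \<open>e1\<close>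
  and \<open>e2\<close> regarded as real vectors in the plane.\<close>

lemma complex_real_basis:
  assumes "Im (cnj e1 * e2) \<noteq> 0"
  shows "complex_of_real (- Im (cnj e2 * q) / Im (cnj e1 * e2)) * e1
       + complex_of_real (Im (cnj e1 * q) / Im (cnj e1 * e2)) * e2 = q"
proof -
  define D where "D = Im (cnj e1 * e2)"
  have D: "D \<noteq> 0" "D = Re e1 * Im e2 - Im e1 * Re e2" using assms by (simp_all add: D_def)
  have "D * (- Im (cnj e2 * q) / D * Re e1 + Im (cnj e1 * q) / D * Re e2) = D * Re q"
    "D * (- Im (cnj e2 * q) / D * Im e1 + Im (cnj e1 * q) / D * Im e2) = D * Im q"
    using D(1) by (simp_all add: distrib_left) (simp_all add: D(2) algebra_simps)
  then show ?thesis unfolding D_def[symmetric] using D(1) by (simp add: complex_eq_iff)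
qed

text \<open>Up to the positive factor \<open>g * c\<close> the product is
  \<open>v * (1 + x) * (1 + y)\<close> with x and y of modulus at most \<tau>. As
  \<open>\<tau> \<le> 1\<close>, the factor \<open>(1 + x) * (1 + y)\<close> lies within
  \<open>3 * \<tau>\<close> of 1, too close to bring the imaginary part of v to zero.\<close>

lemma Im_almost_positive_multiple_nonzero:
  assumes "0 < g" "0 < c" and G: "norm (G - complex_of_real g) \<le> \<tau> * g"
    and C: "norm (C - complex_of_real c) \<le> \<tau> * c"
    and \<tau>: "0 \<le> \<tau>" "\<tau> \<le> 1" "3 * \<tau> * norm v < \<bar>Im v\<bar>"
  shows "Im (cnj G * (v * C)) \<noteq> 0"
proof -
  define x where "x = cnj (G - complex_of_real g) / complex_of_real g"
  define y where "y = (C - complex_of_real c) / complex_of_real c"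
  have x: "norm x \<le> \<tau>" unfolding x_def norm_divide complex_mod_cnj norm_of_real
    using assms(1) G by (simp add: divide_simps)
  have y: "norm y \<le> \<tau>" unfolding y_def norm_divide norm_of_real
    using assms(2) C by (simp add: divide_simps)
  have "norm (x + y + x * y) \<le> norm x + norm y + norm (x * y)"
    by (intro order_trans[OF norm_triangle_ineq] add_right_mono norm_triangle_ineq)
  also have "\<dots> \<le> \<tau> + \<tau> + 1 * \<tau>"
    unfolding norm_mult using x y \<tau> by (intro add_mono mult_mono) auto
  finally have xy: "norm (x + y + x * y) \<le> 3 * \<tau>" by simp
  have "\<bar>Im (v * (x + y + x * y))\<bar> \<le> norm v * norm (x + y + x * y)"
    using abs_Im_le_cmod[of "v * (x + y + x * y)"] by (simp add: norm_mult)
  also have "\<dots> \<le> norm v * (3 * \<tau>)" by (intro mult_left_mono xy) auto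
  finally have "Im v + Im (v * (x + y + x * y)) \<noteq> 0" using \<tau>(3) by (auto simp: mult_ac)
  then have ne: "Im (v * (1 + (x + y + x * y))) \<noteq> 0" by (simp only: distrib_left mult_1_right plus_complex.sel not_False_eq_True)
  have GC: "cnj G = complex_of_real g * (1 + x)" "C = complex_of_real c * (1 + y)"
    using assms(1,2) by (simp_all add: x_def y_def field_simps)
  have "cnj G * (v * C) = complex_of_real (g * c) * (v * (1 + (x + y + x * y)))"
    unfolding GC by (simp add: algebra_simps)
  then have "Im (cnj G * (v * C)) = (g * c) * Im (v * (1 + (x + y + x * y)))"
    by (simp only: times_complex.sel Re_complex_of_real Im_complex_of_real)
  then show ?thesis using ne assms(1,2) by simp
qed

text \<open>The tent is positive on all points from \<open>a\<close> up to, but excluding,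
  \<open>b\<close>. A vanishing integral would thus put almost all mass at or beyond
  \<open>b\<close>. Positivity of \<open>a\<close> matters here, since the tent vanishes at
  0.\<close>

lemma (in bumped_string) bump_integrals_pos:
  assumes a: "0 < a" "AE s in M. a \<le> s" and nb: "\<not> (AE s in M. b \<le> s)"
  shows "0 < (\<integral>s. bump s \<partial>M)" "0 < (\<integral>(t, s). bump (max t s) \<partial>(M \<Otimes>\<^sub>M M))"
    and "integrable M bump" "integrable (M \<Otimes>\<^sub>M M) (\<lambda>(t, s). bump (max t s))"
proof -
  interpret P: pair_sigma_finite M M ..
  have bump0: "b \<le> s" if "bump s = 0" "a \<le> s" for s
    using that a(1) by (auto simp: bump_def split: if_splits)
  have [measurable]: "bump \<in> borel_measurable M" using measurable_bump[OF measurable_M_ident] by simp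
  show int: "integrable M bump"
    using bump_le bump_nonneg by (intro integrable_const_bound[where B = l]) auto
  have bumpm: "bump (max t s) \<le> l" if "t \<in> {0..l}" "s \<in> {0..l}" for t s
    using that by (intro bump_le) (auto simp: max_def)
  show int2: "integrable (M \<Otimes>\<^sub>M M) (\<lambda>(t, s). bump (max t s))"
    by (rule pair_integrable_bounded[where B = l]) (use bumpm bump_nonneg in auto)
  have "(\<integral>s. bump s \<partial>M) \<noteq> 0"
  proof
    assume "(\<integral>s. bump s \<partial>M) = 0"
    then have "AE s in M. bump s = 0"
      using int bump_nonneg by (subst (asm) integral_nonneg_eq_0_iff_AE) auto
    with a(2) have "AE s in M. b \<le> s" by eventually_elim (use bump0 in auto)
    then show False using nb by blast
  qed
  then show "0 < (\<integral>s. bump s \<partial>M)"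
    using Bochner_Integration.integral_nonneg[of M bump] bump_nonneg by (simp add: order_less_le)
  have "(\<integral>(t, s). bump (max t s) \<partial>(M \<Otimes>\<^sub>M M)) \<noteq> 0"
  proof
    assume "(\<integral>(t, s). bump (max t s) \<partial>(M \<Otimes>\<^sub>M M)) = 0"
    then have "AE p in M \<Otimes>\<^sub>M M. (case p of (t, s) \<Rightarrow> bump (max t s)) = 0"
      using int2 bump_nonneg by (subst (asm) integral_nonneg_eq_0_iff_AE) auto
    then have "AE t in M. AE s in M. bump (max t s) = 0" using P.AE_pair by fastforce
    with a(2) have "AE t in M. b \<le> t"
    proof eventually_elim
      case (elim t)
      show "b \<le> t"
      proof (rule ccontr)
        assume "\<not> b \<le> t"
        from elim(2) have "AE s in M. b \<le> s"
        proof eventually_elim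
          case (elim s)
          then have "b \<le> max t s" using bump0[of "max t s"] \<open>a \<le> t\<close> by auto
          then show "b \<le> s" using \<open>\<not> b \<le> t\<close> by auto
        qed
        then show False using nb by blast
      qed
    qed
    then show False using nb by blast
  qed
  moreover have "0 \<le> (\<integral>(t, s). bump (max t s) \<partial>(M \<Otimes>\<^sub>M M))"
    by (rule Bochner_Integration.integral_nonneg) (auto simp: bump_nonneg)
  ultimately show "0 < (\<integral>(t, s). bump (max t s) \<partial>(M \<Otimes>\<^sub>M M))" by simp
qed

section \<open>Choice of the bump, of the disc of parameters and of the upward shift\<close>

context krein_string begin

text \<open>For \<open>x \<le> a\<close> the kernel \<open>max 0 (x - s)\<close> vanishes almost
  everywhere, so \<phi> equals 1 up to and including \<open>a\<close>, even if \<open>a\<close>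
  carries an atom. Continuity extends this approximately to the right of \<open>a\<close>.\<close>

lemma string_phi_near_left_end:
  assumes a: "AE s in M. a \<le> s" "0 \<le> a" "a < l" and \<epsilon>: "0 < \<epsilon>"
  obtains b where "a < b" "b \<le> l" "\<And>s. 0 \<le> s \<Longrightarrow> s \<le> b \<Longrightarrow> norm (string_phi l M z s - 1) \<le> \<epsilon>"
proof -
  let ?\<phi> = "string_phi l M z"
  have one: "?\<phi> x = 1" if "0 \<le> x" "x \<le> a" for x
  proof -
    have "(\<integral>s. complex_of_real (max 0 (x - s)) * ?\<phi> s \<partial>M) = 0"
    proof (rule integral_eq_zero_AE)
      show "AE s in M. complex_of_real (max 0 (x - s)) * ?\<phi> s = 0"
        using a(1) by eventually_elim (use that in auto)
    qed
    then show ?thesis using string_phi_eq[of x z] that a by simp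
  qed
  obtain d where d: "0 < d" "\<And>x. x \<in> {0..l} \<Longrightarrow> dist x a < d \<Longrightarrow> dist (?\<phi> x) (?\<phi> a) < \<epsilon>"
    using continuous_on_string_phi[of z] a \<epsilon> unfolding continuous_on_iff by (metis atLeastAtMost_iff less_imp_le)
  define b where "b = min l (a + d / 2)"
  show ?thesis
  proof (rule that)
    show "a < b" "b \<le> l" using a d by (auto simp: b_def)
    fix s assume s: "0 \<le> s" "s \<le> b"
    show "norm (?\<phi> s - 1) \<le> \<epsilon>"
    proof (cases "s \<le> a")
      case False
      then have "dist s a < d" "s \<in> {0..l}" using s d by (auto simp: b_def dist_real_def)
      then show ?thesis using d(2)[of s] one[of a] a by (simp add: dist_norm)
    qed (use s one \<epsilon> in auto)
  qed
qed

lemma quasi_eigenvalue_can_move_up: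
  assumes F: "string_F l M \<omega> = 0" and Re: "Re \<omega> \<noteq> 0" and mass: "total_mass M < m"
    and a: "0 < a" "a \<le> l" "AE s in M. a \<le> s" "\<And>b. a < b \<Longrightarrow> \<not> (AE s in M. b \<le> s)"
  obtains \<eta> M' where "0 < \<eta>" "is_string l M'" "total_mass M' \<le> m"
    "string_F l M' (\<omega> + \<i> * complex_of_real \<eta>) = 0"
proof -
  let ?\<phi> = "string_phi l M \<omega>"
  have "a \<noteq> l" using Re_zero_if_mass_at_end[OF F] Re a(3) by auto
  then have al: "a < l" using a(2) by simp
  have "Im \<omega> < 0" by (rule quasi_eigenvalue_Im_neg[OF F])
  then have im: "Im (\<omega>\<^sup>2) \<noteq> 0" using Re by (simp add: power2_eq_square)
  then have \<omega>0: "\<omega> \<noteq> 0" by auto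
  \<comment> \<open>Products of two values of \<phi> deviate from 1 by at most
    \<open>3 * \<epsilon>\<close>, and the nonvanishing criterion triples this once more; the
    constant 18 makes \<open>9 * \<epsilon> * norm (\<omega>\<^sup>2)\<close> half of the admissible
    bound.\<close>
  define \<epsilon> where "\<epsilon> = \<bar>Im (\<omega>\<^sup>2)\<bar> / (18 * norm (\<omega>\<^sup>2))"
  have \<epsilon>: "0 < \<epsilon>" using im \<omega>0 by (simp add: \<epsilon>_def)
  have \<epsilon>1: "\<epsilon> \<le> 1 / 18" using abs_Im_le_cmod[of "\<omega>\<^sup>2"] \<omega>0 by (simp add: \<epsilon>_def divide_simps)
  obtain b where b: "a < b" "b \<le> l" "\<And>s. 0 \<le> s \<Longrightarrow> s \<le> b \<Longrightarrow> norm (?\<phi> s - 1) \<le> \<epsilon>"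
    using string_phi_near_left_end[OF a(3) _ al \<epsilon>, of \<omega>] a(1) by auto
  interpret bumped_string l M b by standard (use a b in auto)
  note pos = bump_integrals_pos[OF a(1,3) a(4)[OF b(1)]]
  define G where "G = (\<integral>s. complex_of_real (bump s) * (?\<phi> s)\<^sup>2 \<partial>M)"
  define C where "C = (\<integral>(t, s). ?\<phi> t * ?\<phi> s * complex_of_real (bump (max t s)) \<partial>(M \<Otimes>\<^sub>M M))"
  define g where "g = (\<integral>s. bump s \<partial>M)"
  define c where "c = (\<integral>(t, s). bump (max t s) \<partial>(M \<Otimes>\<^sub>M M))"
  obtain B where B: "0 < B" "\<And>x. x \<in> {0..l} \<Longrightarrow> norm (?\<phi> x) \<le> B"
    using bounded_continuous[OF continuous_on_string_phi] by blast
  have \<phi>\<phi>: "norm (?\<phi> t * ?\<phi> s - 1) \<le> 3 * \<epsilon>" if "0 \<le> t" "t \<le> b" "0 \<le> s" "s \<le> b" for t s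
  proof -
    have "norm (?\<phi> s) \<le> norm (?\<phi> s - 1) + 1" using norm_triangle_ineq[of "?\<phi> s - 1" 1] by simp
    then have s2: "norm (?\<phi> s) \<le> 2" using b(3)[of s] that \<epsilon>1 by linarith
    have "?\<phi> t * ?\<phi> s - 1 = (?\<phi> t - 1) * ?\<phi> s + (?\<phi> s - 1)" by (simp add: algebra_simps)
    also have "norm \<dots> \<le> norm (?\<phi> t - 1) * norm (?\<phi> s) + norm (?\<phi> s - 1)"
      by (metis norm_mult norm_triangle_ineq)
    also have "\<dots> \<le> \<epsilon> * 2 + \<epsilon>" using b(3) that s2 \<epsilon> by (intro add_mono mult_mono) auto
    finally show ?thesis by simp
  qed
  have bump_b: "s \<le> b" if "bump s \<noteq> 0" for s using that by (auto simp: bump_def split: if_splits)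
  have G: "norm (G - complex_of_real g) \<le> (3 * \<epsilon>) * g"
  proof -
    have "G - complex_of_real g = (\<integral>s. complex_of_real (bump s) * (?\<phi> s)\<^sup>2 - complex_of_real (bump s) \<partial>M)"
      unfolding G_def g_def integral_complex_of_real[symmetric]
      by (rule Bochner_Integration.integral_diff[symmetric])
        (auto intro!: integrable_continuous continuous_intros pos(3) simp: bump_def)
    also have "norm \<dots> \<le> (\<integral>s. norm (complex_of_real (bump s) * (?\<phi> s)\<^sup>2 - complex_of_real (bump s)) \<partial>M)"
      by (rule integral_norm_bound)
    also have "\<dots> \<le> (\<integral>s. (3 * \<epsilon>) * bump s \<partial>M)"
    proof (rule integral_mono')
      fix s assume "s \<in> space M"
      then have s: "s \<in> {0..l}" by simp
      have "complex_of_real (bump s) * (?\<phi> s)\<^sup>2 - complex_of_real (bump s) = (?\<phi> s * ?\<phi> s - 1) * complex_of_real (bump s)"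
        by (simp add: power2_eq_square algebra_simps)
      moreover have "norm (?\<phi> s * ?\<phi> s - 1) * bump s \<le> (3 * \<epsilon>) * bump s"
        using \<phi>\<phi>[of s s] bump_b[of s] s bump_nonneg[of s] by (cases "bump s = 0") (auto intro!: mult_right_mono)
      ultimately show "norm (complex_of_real (bump s) * (?\<phi> s)\<^sup>2 - complex_of_real (bump s)) \<le> (3 * \<epsilon>) * bump s"
        using bump_nonneg[of s] by (simp add: norm_mult)
    qed (use pos(3) bump_nonneg \<epsilon> in auto)
    also have "\<dots> = (3 * \<epsilon>) * g" by (simp add: g_def)
    finally show ?thesis .
  qed
  have C: "norm (C - complex_of_real c) \<le> (3 * \<epsilon>) * c"
  proof -
    have intC: "integrable (M \<Otimes>\<^sub>M M) (\<lambda>(t, s). ?\<phi> t * ?\<phi> s * complex_of_real (bump (max t s)))"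
    proof (rule pair_integrable_bounded)
      fix t s assume ts: "t \<in> {0..l}" "s \<in> {0..l}"
      then have "bump (max t s) \<le> l" by (intro bump_le) (auto simp: max_def)
      then show "norm (case (t, s) of (t, s) \<Rightarrow> ?\<phi> t * ?\<phi> s * complex_of_real (bump (max t s))) \<le> (B * B) * l"
        unfolding prod.case norm_mult norm_of_real
        using B ts l_pos bump_nonneg[of "max t s"] by (intro mult_mono) auto
    qed measurable
    define f where "f p = ?\<phi> (fst p) * ?\<phi> (snd p)" for p
    define h where "h p = bump (max (fst p) (snd p))" for p
    have Cf: "C = (\<integral>p. f p * complex_of_real (h p) \<partial>(M \<Otimes>\<^sub>M M))" and ch: "c = (\<integral>p. h p \<partial>(M \<Otimes>\<^sub>M M))"
      by (simp_all add: C_def c_def f_def h_def case_prod_beta')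
    have int_f: "integrable (M \<Otimes>\<^sub>M M) (\<lambda>p. f p * complex_of_real (h p))" and int_h: "integrable (M \<Otimes>\<^sub>M M) h"
      using intC pos(4) by (simp_all add: f_def h_def[abs_def] case_prod_beta')
    have "C - complex_of_real c = (\<integral>p. f p * complex_of_real (h p) - complex_of_real (h p) \<partial>(M \<Otimes>\<^sub>M M))"
      unfolding Cf ch integral_complex_of_real[symmetric]
      by (rule Bochner_Integration.integral_diff[symmetric, OF int_f integrable_of_real[OF int_h]])
    also have "norm \<dots> \<le> (\<integral>p. norm (f p * complex_of_real (h p) - complex_of_real (h p)) \<partial>(M \<Otimes>\<^sub>M M))"
      by (rule integral_norm_bound)
    also have "\<dots> \<le> (\<integral>p. (3 * \<epsilon>) * h p \<partial>(M \<Otimes>\<^sub>M M))"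
    proof (rule integral_mono')
      show "integrable (M \<Otimes>\<^sub>M M) (\<lambda>p. (3 * \<epsilon>) * h p)" using int_h by simp
      fix p assume "p \<in> space (M \<Otimes>\<^sub>M M)"
      then have ts: "fst p \<in> {0..l}" "snd p \<in> {0..l}"
        by (auto simp: space_pair_measure)
      have h0: "0 \<le> h p" by (simp add: h_def bump_nonneg)
      have "f p * complex_of_real (h p) - complex_of_real (h p) = (f p - 1) * complex_of_real (h p)"
        by (simp add: algebra_simps)
      then have "norm (f p * complex_of_real (h p) - complex_of_real (h p)) = norm (f p - 1) * h p"
        using h0 by (simp only: norm_mult norm_of_real abs_of_nonneg)
      also have "\<dots> \<le> (3 * \<epsilon>) * h p"
      proof (cases "h p = 0")
        case False
        then have "max (fst p) (snd p) \<le> b" unfolding h_def by (rule bump_b)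
        then have "norm (f p - 1) \<le> 3 * \<epsilon>" unfolding f_def using ts by (intro \<phi>\<phi>) auto
        then show ?thesis using h0 by (intro mult_right_mono)
      qed simp
      finally show "norm (f p * complex_of_real (h p) - complex_of_real (h p)) \<le> (3 * \<epsilon>) * h p" .
      show "0 \<le> (3 * \<epsilon>) * h p" using h0 \<epsilon> by simp
    qed
    also have "\<dots> = (3 * \<epsilon>) * c" by (simp add: ch)
    finally show ?thesis .
  qed
  \<comment> \<open>The partial derivatives with respect to \<kappa> and \<delta> of minus
    \<open>F\<close> times the momentum; \<open>D\<close> is their determinant.\<close>
  define e1 where "e1 = G"
  define e2 where "e2 = - (\<omega>\<^sup>2) * C"
  define D where "D = Im (cnj e1 * e2)"
  have "Im (cnj G * (\<omega>\<^sup>2 * C)) \<noteq> 0"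
  proof (rule Im_almost_positive_multiple_nonzero)
    show "3 * (3 * \<epsilon>) * norm (\<omega>\<^sup>2) < \<bar>Im (\<omega>\<^sup>2)\<bar>" using im \<omega>0 by (simp add: \<epsilon>_def)
  qed (use G C pos \<epsilon> \<epsilon>1 in \<open>auto simp: g_def c_def\<close>)
  then have D: "D \<noteq> 0" by (simp add: D_def e1_def e2_def)
  define k where "k q = - Im (cnj e2 * q) / D" for q
  define d where "d q = Im (cnj e1 * q) / D" for q
  have kd: "complex_of_real (k q) * e1 + complex_of_real (d q) * e2 = q" for q
    using complex_real_basis D unfolding k_def d_def D_def by blast
  define \<Lambda> where "\<Lambda> = (norm e1 + norm e2) / \<bar>D\<bar>"
  have "e1 \<noteq> 0" using D by (auto simp: D_def)
  then have \<Lambda>: "0 < \<Lambda>" using D unfolding \<Lambda>_def by (intro divide_pos_pos add_pos_nonneg) auto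
  have kd_le: "\<bar>k q\<bar> + \<bar>d q\<bar> \<le> \<Lambda> * norm q" for q
  proof -
    have "\<bar>Im (cnj e2 * q)\<bar> \<le> norm e2 * norm q" "\<bar>Im (cnj e1 * q)\<bar> \<le> norm e1 * norm q"
      using abs_Im_le_cmod[of "cnj e2 * q"] abs_Im_le_cmod[of "cnj e1 * q"]
      unfolding norm_mult complex_mod_cnj by blast+
    then have "\<bar>k q\<bar> + \<bar>d q\<bar> \<le> (norm e2 * norm q) / \<bar>D\<bar> + (norm e1 * norm q) / \<bar>D\<bar>"
      unfolding k_def d_def abs_divide abs_minus_cancel by (intro add_mono divide_right_mono) auto
    also have "\<dots> = \<Lambda> * norm q" by (simp add: \<Lambda>_def add_divide_distrib distrib_right)
    finally show ?thesis .
  qed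
  obtain K where K: "0 \<le> K" and exp: "\<And>\<kappa> \<delta> \<eta>. small \<kappa> \<delta> \<Longrightarrow> 0 \<le> \<eta> \<Longrightarrow> \<eta> \<le> 1 \<Longrightarrow> \<bar>\<kappa>\<bar> + \<bar>\<delta>\<bar> \<le> 1 \<Longrightarrow>
      norm (string_F l (pert \<kappa> \<delta>) (\<omega> + \<i> * complex_of_real \<eta>) * (\<integral>s. ?\<phi> s \<partial>M)
         + (complex_of_real \<kappa> * G - \<omega>\<^sup>2 * complex_of_real \<delta> * C)) \<le> K * (\<eta> + (\<bar>\<kappa>\<bar> + \<bar>\<delta>\<bar>)\<^sup>2)"
    using string_F_pert_expansion[OF F] unfolding G_def C_def by blast
  define \<mu> where "\<mu> = total_mass M"
  have \<mu>: "0 \<le> \<mu>" "\<mu> < m" using mass by (simp_all add: \<mu>_def total_mass_def)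
  define A where "A = (K + 1) * \<Lambda>\<^sup>2"
  have A: "0 < A" using K \<Lambda> by (simp add: A_def)
  \<comment> \<open>The first two entries make the parameters \<open>small\<close>, the third keeps
    the added mass within \<open>m - \<mu>\<close>, the fourth bounds the quadratic error by
    \<open>r / 2\<close>. The summands 1 in \<open>\<mu> + 1\<close> and \<open>K + 1\<close> keep
    the denominators positive.\<close>
  define r where "r = Min {1 / (2 * \<Lambda>), 1 / (2 * \<Lambda> * l), (m - \<mu>) / (\<Lambda> * l * (\<mu> + 1)), 1 / (2 * A)}"
  have r: "0 < r" unfolding r_def using \<Lambda> l_pos \<mu> A by (subst Min_gr_iff) auto
  have "r \<le> 1 / (2 * \<Lambda>)" "r \<le> 1 / (2 * \<Lambda> * l)" "r \<le> (m - \<mu>) / (\<Lambda> * l * (\<mu> + 1))" "r \<le> 1 / (2 * A)"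
    unfolding r_def by (rule Min_le; simp)+
  then have r1: "\<Lambda> * r \<le> 1 / 2" and r2: "(\<Lambda> * r) * l \<le> 1 / 2"
    and r3: "(\<Lambda> * r) * (l * (\<mu> + 1)) \<le> m - \<mu>" and r4: "A * r \<le> 1 / 2"
    using \<Lambda> l_pos \<mu> A by (simp_all add: divide_simps mult_ac)
  \<comment> \<open>Chosen after r, so that the linear error \<open>K * \<eta>\<close> takes at most
    the other half of r.\<close>
  define \<eta> where "\<eta> = min 1 (r / (2 * (K + 1)))"
  have \<eta>: "0 < \<eta>" "\<eta> \<le> 1" using r K by (auto simp: \<eta>_def)
  have "\<eta> \<le> r / (2 * (K + 1))" by (simp add: \<eta>_def)
  then have K\<eta>: "K * \<eta> \<le> r / 2" using K \<eta>(1) by (simp add: field_simps)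
  define z' where "z' = \<omega> + \<i> * complex_of_real \<eta>"
  have kd_r: "\<bar>k q\<bar> + \<bar>d q\<bar> \<le> \<Lambda> * r" if "norm q \<le> r" for q
    using kd_le[of q] mult_left_mono[OF that less_imp_le[OF \<Lambda>]] by simp
  have sm: "small (k q) (d q)" if "norm q \<le> r" for q
  proof -
    have "\<bar>k q\<bar> * l \<le> (\<Lambda> * r) * l" using kd_r[OF that] l_pos by (intro mult_right_mono) auto
    then show ?thesis using r1 r2 kd_r[OF that] by (simp add: small_def)
  qed
  \<comment> \<open>In the coordinates \<open>k\<close> and \<open>d\<close> the linear part of
    \<Psi> is q itself, so \<Psi> is close to the identity on the disc.\<close>
  define \<Psi> where "\<Psi> q = - (string_F l (pert (k q) (d q)) z' * (\<integral>s. ?\<phi> s \<partial>M))" for q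
  have "continuous_on (cball 0 r) \<Psi>"
    unfolding \<Psi>_def
  proof (intro continuous_intros continuous_string_F_pert)
    show "continuous_on (cball 0 r) k" "continuous_on (cball 0 r) d"
      unfolding k_def d_def using D by (auto intro!: continuous_intros)
  qed (use sm in auto)
  moreover have "norm (q - \<Psi> q) \<le> r" if q: "norm q \<le> r" for q
  proof -
    have p: "\<bar>k q\<bar> + \<bar>d q\<bar> \<le> 1" using kd_r[OF q] r1 by simp
    have "complex_of_real (k q) * G - \<omega>\<^sup>2 * complex_of_real (d q) * C = q"
      using kd[of q] by (simp add: e1_def e2_def mult_ac)
    then have "norm (q - \<Psi> q) \<le> K * (\<eta> + (\<bar>k q\<bar> + \<bar>d q\<bar>)\<^sup>2)"
      using exp[OF sm[OF q] less_imp_le[OF \<eta>(1)] \<eta>(2) p] by (simp add: \<Psi>_def z'_def add.commute)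
    also have "\<dots> \<le> K * (\<eta> + (\<Lambda> * r)\<^sup>2)"
      using kd_r[OF q] K by (intro mult_left_mono add_left_mono power_mono) auto
    also have "\<dots> = K * \<eta> + (K * \<Lambda>\<^sup>2 * r) * r" by (simp add: power2_eq_square algebra_simps)
    also have "\<dots> \<le> r / 2 + (1 / 2) * r"
    proof (intro add_mono K\<eta> mult_right_mono)
      have "K * \<Lambda>\<^sup>2 * r \<le> A * r" unfolding A_def using r by (intro mult_right_mono) auto
      then show "K * \<Lambda>\<^sup>2 * r \<le> 1 / 2" using r4 by simp
    qed (use r in auto)
    finally show ?thesis by simp
  qed
  ultimately obtain q where q: "norm q \<le> r" "\<Psi> q = 0"
    using complex_zero_near_identity[OF r] by blast
  have zero: "string_F l (pert (k q) (d q)) z' = 0"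
    using q(2) integral_string_phi_nonzero[OF F] by (simp add: \<Psi>_def)
  note facts = pert_phi_facts(5,6)[OF sm[OF q(1)]]
  \<comment> \<open>Displacement preserves mass, so only the density counts; this is where the
    strict inequality \<open>total_mass M < m\<close> is spent.\<close>
  have "total_mass (pert (k q) (d q)) \<le> (\<integral>s. 1 + (\<Lambda> * r) * l \<partial>M)"
    unfolding facts(2)
  proof (rule integral_mono')
    fix s assume "s \<in> space M"
    then have s: "s \<in> {0..l}" by simp
    have "k q * bump s \<le> \<bar>k q\<bar> * bump s" using bump_nonneg by (intro mult_right_mono) auto
    also have "\<dots> \<le> (\<Lambda> * r) * l"
      using kd_r[OF q(1)] bump_le[OF s] bump_nonneg[of s] \<Lambda> r by (intro mult_mono) auto
    finally show "w (k q) s \<le> 1 + (\<Lambda> * r) * l" by (simp add: w_def)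
  qed (use \<Lambda> r l_pos in auto)
  also have "\<dots> = \<mu> + ((\<Lambda> * r) * l) * \<mu>" by (simp add: \<mu>_def total_mass_def algebra_simps)
  also have "\<dots> \<le> \<mu> + ((\<Lambda> * r) * l) * (\<mu> + 1)" using \<Lambda> r l_pos by (intro add_left_mono mult_left_mono) auto
  also have "\<dots> \<le> m" using r3 by (simp add: mult_ac)
  finally have "total_mass (pert (k q) (d q)) \<le> m" .
  then show ?thesis using that[OF \<eta>(1) facts(1)] zero by (simp add: z'_def)
qed

text \<open>Without mass the momentum would vanish. This excludes the conventional value
  \<open>l\<close> of \<open>a_star\<close> for the zero string.\<close>

lemma total_mass_nonzero:
  assumes "string_F l M z = 0" shows "total_mass M \<noteq> 0"
proof
  assume "total_mass M = 0"
  then have "measure M {0..l} = 0" by (simp add: total_mass_def)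
  moreover obtain B where "0 < B" "\<And>x. x \<in> {0..l} \<Longrightarrow> norm (string_phi l M z x) \<le> B"
    using bounded_continuous[OF continuous_on_string_phi] by blast
  ultimately have "norm (\<integral>s. string_phi l M z s \<partial>M) \<le> 0"
    using norm_integral_le[of "string_phi l M z" B] by simp
  then show False using integral_string_phi_nonzero[OF assms] by simp
qed

end

section \<open>The minimal decay rate as a lower bound, and the contradiction with
  minimality\<close>

lemma beta_min_le:
  assumes "0 < l" "is_string l M" "total_mass M \<le> m"
    and "string_F l M (complex_of_real \<alpha> - \<i> * complex_of_real \<beta>) = 0"
  shows "beta_min l m \<alpha> \<le> \<beta>"
  unfolding beta_min_def
proof (rule cInf_lower)
  show "\<beta> \<in> {\<beta>. complex_of_real \<alpha> - \<i> * complex_of_real \<beta> \<in> admissible_quasi_eigenvalues l m}"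
    using assms by (auto simp: admissible_quasi_eigenvalues_def admissible_def quasi_eigenvalues_def)
  show "bdd_below {\<beta>. complex_of_real \<alpha> - \<i> * complex_of_real \<beta> \<in> admissible_quasi_eigenvalues l m}"
  proof (rule bdd_belowI)
    fix \<gamma> assume "\<gamma> \<in> {\<beta>. complex_of_real \<alpha> - \<i> * complex_of_real \<beta> \<in> admissible_quasi_eigenvalues l m}"
    then obtain N where N: "is_string l N" "string_F l N (complex_of_real \<alpha> - \<i> * complex_of_real \<gamma>) = 0"
      by (auto simp: admissible_quasi_eigenvalues_def admissible_def quasi_eigenvalues_def)
    interpret krein_string l N by standard (use assms N in auto)
    show "0 \<le> \<gamma>" using quasi_eigenvalue_Im_neg[OF N(2)] by simp
  qed
qed

theorem corollary8p1:
  fixes l m \<alpha> :: real and M\<^sub>0 :: "real measure"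
  assumes "l > 0" and "m > 0"
    and "minimal_decay l m \<alpha> M\<^sub>0"
  shows "total_mass M\<^sub>0 = m \<or> a_star l M\<^sub>0 = 0"
proof (rule ccontr)
  assume neg: "\<not> (total_mass M\<^sub>0 = m \<or> a_star l M\<^sub>0 = 0)"
  define \<beta> where "\<beta> = beta_min l m \<alpha>"
  define \<omega> where "\<omega> = complex_of_real \<alpha> - \<i> * complex_of_real \<beta>"
  have M: "is_string l M\<^sub>0" "total_mass M\<^sub>0 \<le> m" and F: "string_F l M\<^sub>0 \<omega> = 0"
    using assms(3) by (auto simp: minimal_decay_def admissible_def quasi_eigenvalues_def \<omega>_def \<beta>_def)
  interpret krein_string l M\<^sub>0 by standard (use assms(1) M(1) in auto)
  have mass: "total_mass M\<^sub>0 \<noteq> 0" by (rule total_mass_nonzero[OF F])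
  then have mass_pos: "0 < total_mass M\<^sub>0" by (simp add: total_mass_def zero_less_measure_iff)
  have mass_lt: "total_mass M\<^sub>0 < m" using neg M(2) by simp
  obtain r where r: "0 < r" "AE s in M\<^sub>0. r \<le> s" using AE_away_from_0 neg mass by blast
  show False
  proof (cases "\<alpha> = 0")
    case True
    have \<beta>: "0 < \<beta>" using quasi_eigenvalue_Im_neg[OF F] by (simp add: \<omega>_def)
    \<comment> \<open>If all mass sits at \<open>l\<close>, then r may equal \<open>l\<close>; the
      cut at \<open>l / 2\<close> keeps \<open>l - r'\<close> positive.\<close>
    define r' where "r' = min r (l / 2)"
    have r': "0 < r'" "r' < l" using r(1) assms(1) by (auto simp: r'_def)
    have AE: "AE s in M\<^sub>0. r' \<le> s" using r(2) by eventually_elim (simp add: r'_def)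
    \<comment> \<open>The first entry is the largest stretching for which the string still fits, the
      second the largest that the mass budget allows. Both exceed 1.\<close>
    define c where "c = min (l / (l - r')) (m / total_mass M\<^sub>0)"
    have c: "1 < c" using r' mass_lt mass_pos by (auto simp: c_def divide_simps)
    have "c * (l - r') \<le> l / (l - r') * (l - r')" using r' by (intro mult_right_mono) (auto simp: c_def)
    then have cl: "c * (l - r') \<le> l" using r' by simp
    have "c * total_mass M\<^sub>0 \<le> m / total_mass M\<^sub>0 * total_mass M\<^sub>0"
      using mass_pos by (intro mult_right_mono) (auto simp: c_def)
    then have cm: "c * total_mass M\<^sub>0 \<le> m" using mass_pos by simp
    obtain M' where M': "is_string l M'" "total_mass M' = c * total_mass M\<^sub>0"
      "string_F l M' (\<omega> / complex_of_real c) = 0"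
      using stretched_string[OF F AE _ cl] c by auto
    \<comment> \<open>Division by c preserves the frequency because it is zero, and it lowers the
      decay rate to \<open>\<beta> / c\<close>.\<close>
    have "\<omega> / complex_of_real c = complex_of_real \<alpha> - \<i> * complex_of_real (\<beta> / c)"
      using True by (simp add: \<omega>_def)
    then have "\<beta> \<le> \<beta> / c"
      unfolding \<beta>_def using beta_min_le[OF assms(1) M'(1)] M'(2,3) cm \<beta>_def by simp
    then show False using c \<beta> by (simp add: divide_simps)
  next
    case False
    obtain a where a: "0 < a" "a \<le> l" "AE s in M\<^sub>0. a \<le> s" "\<And>b. a < b \<Longrightarrow> \<not> (AE s in M\<^sub>0. b \<le> s)"
      using left_end_of_support[OF mass r] by blast
    obtain \<eta> M' where M': "0 < \<eta>" "is_string l M'" "total_mass M' \<le> m"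
      "string_F l M' (\<omega> + \<i> * complex_of_real \<eta>) = 0"
      using quasi_eigenvalue_can_move_up[OF F _ mass_lt a] False by (auto simp: \<omega>_def)
    have "\<omega> + \<i> * complex_of_real \<eta> = complex_of_real \<alpha> - \<i> * complex_of_real (\<beta> - \<eta>)"
      by (simp add: \<omega>_def algebra_simps)
    then have "\<beta> \<le> \<beta> - \<eta>"
      unfolding \<beta>_def using beta_min_le[OF assms(1) M'(2,3)] M'(4) \<beta>_def by simp
    then show False using M'(1) by simp
  qed
qed

end
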